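(* Let $n\ge 1$, let $\mathbb{S}^n\subset\mathbb{R}^{n+1}$ be the unit sphere with its usual round Riemannian metric, and let $\mathcal{N}\subset\mathbb{S}^n$ be a complete $\mathcal{C}^2$ submanifold without boundary. Let $\rho(x)=d(x,\mathcal{N})$ be the Riemannian (spherical) distance to $\mathcal{N}$, and let $\mathcal{U}\subseteq \mathbb{S}^n\setminus\mathcal{N}$ be the largest open set such that for every $x\in\mathcal{U}$ the function $\rho$ is smooth at $x$ and there is a unique closest point to $x$ in $\mathcal{N}$. Then the smooth self-convexity property is satisfied: for every geodesic $\gamma$ in the condition metric $g_\kappa=\rho^{-2}g$ on $\mathbb{S}^n\setminus\mathcal{N}$ whose image is contained in $\mathcal{U}$, the real function $$t\mapsto \log\frac{1}{\rho(\gamma(t))}$$ is convex.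
   Context: For a Riemannian manifold $(\mathcal{M},g)$ and a submanifold $\mathcal{N}\subset\mathcal{M}$, the condition metric on $\mathcal{M}\setminus\mathcal{N}$ is $g_{x,\kappa}=d(x,\mathcal{N})^{-2}g_x$, where $d(\cdot,\mathcal{N})$ is the Riemannian distance with respect to $g$. The length of a Lipschitz curve $\gamma:I\to\mathcal{M}\setminus\mathcal{N}$ in the condition metric is $L_\kappa(\gamma)=\int_I\|\dot\gamma(t)\|\,d(\gamma(t),\mathcal{N})^{-1}\,dt$, where $\|\cdot\|$ is the norm of $g$ ($\dot\gamma$ exists almost everywhere). A curve $\gamma:[a,b]\to\mathcal{M}\setminus\mathcal{N}$ parametrized by arc length (with respect to $g_\kappa$) is a minimizing geodesic in the condition metric if $L_\kappa(\gamma)\le L_\kappa(c)$ for every Lipschitz curve $c:[a,b]\to\mathcal{M}\setminus\mathcal{N}$ with $c(a)=\gamma(a)$ and $c(b)=\gamma(b)$. A geodesic in the condition metric is a curve that is locally a minimizing geodesic. "Smooth" for the distance function means of class $\mathcal{C}^2$ near the point. *)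

theory Defs
  imports "HOL-Analysis.Analysis"
begin

text \<open>Curve lengths take values in \<^typ>\<open>ennreal\<close>, so that infinite lengths and distances are
  represented as such.  The integrals are taken over the completed measure \<^const>\<open>lebesgue\<close>, hence
  the arbitrary values of \<^const>\<open>vector_derivative\<close> on a null set are irrelevant.
  All manifolds below carry the Riemannian metric induced by the Euclidean inner product, so the
  Riemannian norm of a tangent vector is its Euclidean norm.\<close>

definition curve_length :: "(real \<Rightarrow> 'a::euclidean_space) \<Rightarrow> ennreal" where
  "curve_length g = (\<integral>\<^sup>+t\<in>{0..1}. ennreal (norm (vector_derivative g (at t))) \<partial>lebesgue)"

text \<open>Infimum of the lengths of the piecewise \<open>C\<^sup>1\<close> curves inside \<open>M\<close>; it is infinite if there is no
  such curve.\<close>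

definition riemannian_dist :: "'a::euclidean_space set \<Rightarrow> 'a \<Rightarrow> 'a \<Rightarrow> ennreal" where
  "riemannian_dist M x y =
     (INF g\<in>{g. valid_path g \<and> path_image g \<subseteq> M \<and> pathstart g = x \<and> pathfinish g = y}.
        curve_length g)"

text \<open>\<open>C\<^sup>2\<close> maps on an open set of a Euclidean space.\<close>

definition C2_on :: "'a::euclidean_space set \<Rightarrow> ('a \<Rightarrow> 'b::real_normed_vector) \<Rightarrow> bool" where
  "C2_on W f \<longleftrightarrow> open W \<and>
     (\<exists>(f' :: 'a \<Rightarrow> 'a \<Rightarrow>\<^sub>L 'b) (f'' :: 'a \<Rightarrow> 'a \<Rightarrow>\<^sub>L ('a \<Rightarrow>\<^sub>L 'b)).
        (\<forall>x\<in>W. (f has_derivative blinfun_apply (f' x)) (at x)) \<and>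
        (\<forall>x\<in>W. (f' has_derivative blinfun_apply (f'' x)) (at x)) \<and>
        continuous_on W f'')"

text \<open>Embedded \<open>C\<^sup>2\<close> submanifold without boundary, by local flattening diffeomorphisms of the
  ambient space.  A subset of the unit sphere is a \<open>C\<^sup>2\<close> submanifold of the sphere iff it is one of the
  ambient Euclidean space.\<close>

definition C2_submanifold :: "'a::euclidean_space set \<Rightarrow> bool" where
  "C2_submanifold N \<longleftrightarrow>
     (\<exists>k. \<forall>p\<in>N. \<exists>W V (\<phi> :: 'a \<Rightarrow> 'a) \<psi>.
        p \<in> W \<and> C2_on W \<phi> \<and> C2_on (\<phi> ` W) \<psi> \<and> (\<forall>x\<in>W. \<psi> (\<phi> x) = x) \<and>
        subspace V \<and> dim V = k \<and> \<phi> ` (N \<inter> W) = \<phi> ` W \<inter> V)"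

text \<open>Completeness for the intrinsic Riemannian distance of \<open>N\<close>.  Every closed (that is, compact)
  submanifold of the sphere is complete in this sense.\<close>

definition riemannian_complete :: "'a::euclidean_space set \<Rightarrow> bool" where
  "riemannian_complete N \<longleftrightarrow>
     (\<forall>\<sigma>::nat \<Rightarrow> 'a. range \<sigma> \<subseteq> N \<longrightarrow>
        (\<forall>e>0. \<exists>k. \<forall>i\<ge>k. \<forall>j\<ge>k. riemannian_dist N (\<sigma> i) (\<sigma> j) < e) \<longrightarrow>
        (\<exists>l\<in>N. (\<lambda>i. riemannian_dist N (\<sigma> i) l) \<longlonglongrightarrow> 0))"

definition sphere_dist :: "'a::euclidean_space \<Rightarrow> 'a \<Rightarrow> ennreal" where
  "sphere_dist = riemannian_dist (sphere 0 1)"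

text \<open>The spherical distance is finite on the unit sphere when the ambient dimension is at least 2, so
  \<^const>\<open>enn2real\<close> loses nothing for \<open>x\<close> in the sphere and \<open>N\<close> a nonempty subset of it.\<close>

definition rho :: "'a::euclidean_space set \<Rightarrow> 'a \<Rightarrow> real" where
  "rho N x = enn2real (INF y\<in>N. sphere_dist x y)"

definition is_closest_point :: "'a::euclidean_space set \<Rightarrow> 'a \<Rightarrow> 'a \<Rightarrow> bool" where
  "is_closest_point N x y \<longleftrightarrow> y \<in> N \<and> sphere_dist x y = (INF z\<in>N. sphere_dist x z)"

text \<open>\<open>f\<close>, a function on the unit sphere, is \<open>C\<^sup>2\<close> near \<open>x\<close>: it is locally the restriction of a \<open>C\<^sup>2\<close>
  function of the ambient space.\<close>

definition sphere_C2_near :: "('a::euclidean_space \<Rightarrow> real) \<Rightarrow> 'a \<Rightarrow> bool" where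
  "sphere_C2_near f x \<longleftrightarrow>
     (\<exists>W F. x \<in> W \<and> C2_on W F \<and> (\<forall>z\<in>W \<inter> sphere 0 1. F z = f z))"

text \<open>The defining property is imposed pointwise, so this union is itself the largest such open set.\<close>

definition smooth_domain :: "'a::euclidean_space set \<Rightarrow> 'a set" where
  "smooth_domain N =
     \<Union>{V. openin (top_of_set (sphere 0 1)) V \<and> V \<subseteq> sphere 0 1 - N \<and>
          (\<forall>x\<in>V. sphere_C2_near (rho N) x \<and> (\<exists>!y. is_closest_point N x y))}"

text \<open>Here \<^term>\<open>inverse 0 = (\<infinity>::ennreal)\<close>, the correct density at points outside \<open>N\<close> with
  \<^prop>\<open>rho N x = 0\<close>; such points exist if \<open>N\<close> is not closed.\<close>

definition condition_length :: "'a::euclidean_space set \<Rightarrow> real \<Rightarrow> real \<Rightarrow> (real \<Rightarrow> 'a) \<Rightarrow> ennreal" where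
  "condition_length N a b \<gamma> =
     (\<integral>\<^sup>+t\<in>{a..b}. ennreal (norm (vector_derivative \<gamma> (at t))) * inverse (ennreal (rho N (\<gamma> t)))
        \<partial>lebesgue)"

text \<open>Being Lipschitz on a compact interval for the Euclidean norm is the same as for the spherical
  distance, these being equivalent metrics on the sphere.\<close>

definition lipschitz_curve :: "'a::euclidean_space set \<Rightarrow> real \<Rightarrow> real \<Rightarrow> (real \<Rightarrow> 'a) \<Rightarrow> bool" where
  "lipschitz_curve N a b \<gamma> \<longleftrightarrow>
     (\<exists>C. C-lipschitz_on {a..b} \<gamma>) \<and> \<gamma> ` {a..b} \<subseteq> sphere 0 1 - N"

definition condition_minimizing_geodesic ::
    "'a::euclidean_space set \<Rightarrow> real \<Rightarrow> real \<Rightarrow> (real \<Rightarrow> 'a) \<Rightarrow> bool" where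
  "condition_minimizing_geodesic N a b \<gamma> \<longleftrightarrow>
     lipschitz_curve N a b \<gamma> \<and>
     (\<forall>s t. a \<le> s \<and> s \<le> t \<and> t \<le> b \<longrightarrow> condition_length N s t \<gamma> = ennreal (t - s)) \<and>
     (\<forall>c. lipschitz_curve N a b c \<and> c a = \<gamma> a \<and> c b = \<gamma> b \<longrightarrow>
        condition_length N a b \<gamma> \<le> condition_length N a b c)"

definition condition_geodesic :: "'a::euclidean_space set \<Rightarrow> real set \<Rightarrow> (real \<Rightarrow> 'a) \<Rightarrow> bool" where
  "condition_geodesic N I \<gamma> \<longleftrightarrow>
     is_interval I \<and>
     (\<forall>t\<in>I. \<exists>a b T. openin (top_of_set I) T \<and> t \<in> T \<and> T \<subseteq> {a..b} \<and> {a..b} \<subseteq> I \<and>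
        condition_minimizing_geodesic N a b \<gamma>)"

end

theory Submission
  imports Defs
begin

text \<open>Let \<open>u = ln \<rho> \<circ> \<gamma>\<close>; the claim is that \<open>u\<close> is concave. No regularity of \<open>\<gamma>\<close> beyond being Lipschitz
  is used. Push \<open>\<gamma>\<close> away from \<open>N\<close> along the field \<open>X = \<rho> grad \<rho> = grad (\<rho>\<^sup>2 / 2)\<close>: the competitor is the radial
  projection to the sphere of \<open>\<gamma> + s \<eta> X(\<gamma>)\<close> with a tent function \<open>\<eta>\<close>. As the distance to a closest point
  of \<open>N\<close> bounds \<open>\<rho>\<close> from above, with equality at the base point, comparing second derivatives along great
  circles gives \<open>|grad \<rho>| = 1\<close> and \<open>Hess (\<rho>\<^sup>2 / 2) \<le> g\<close>. Since \<open>\<gamma>\<close> has Riemannian speed \<open>\<rho>(\<gamma>)\<close> almost everywhere,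
  the condition length density of the competitor is at most \<open>1 + s \<eta>' u' + O(s\<^sup>2)\<close>: the term \<open>s \<eta>\<close> coming from the Hessian
  cancels against the growth of \<open>\<rho>\<close> along \<open>X\<close>. Minimality gives \<open>\<integral> \<eta>' u' \<ge> 0\<close>, which for the tent on
  \<open>[t - d, t + d]\<close> is the midpoint inequality \<open>u (t - d) + u (t + d) \<le> 2 u t\<close>.\<close>

section \<open>Lipschitz functions of a real variable\<close>

text \<open>Why \<open>\<rho>\<^sup>2 / 2\<close> and not \<open>\<rho>\<close>: orthogonally to its
  gradient the Hessian of \<open>\<rho>\<close> is bounded by \<open>cot \<rho>\<close>, which gives
  no uniform bound, whereas \<open>\<rho> * cot \<rho> \<le> 1\<close> bounds the Hessian of
  \<open>\<rho>\<^sup>2 / 2\<close> in all directions at once. Along \<open>X\<close> the function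
  \<open>ln \<rho>\<close> grows at rate \<open>|grad \<rho>|\<^sup>2 = 1\<close>, so to first order
  a push with constant \<open>\<eta>\<close> does not lengthen vectors for
  \<open>g\<^sub>\<kappa>\<close>, and what a cut-off adds is \<open>\<eta>'\<close> times the inner
  product of the velocity with \<open>X / \<rho>\<^sup>2\<close>, that is \<open>\<eta>' u'\<close>.
  The argument is one-sided: it needs \<open>\<eta> \<ge> 0\<close> and \<open>s > 0\<close>, and it
  yields concavity of \<open>u\<close> without any geodesic equation. The obstacle is regularity.
  Velocities exist only almost everywhere, so the length of the competitor is not differentiated in
  \<open>s\<close>; its density is bounded pointwise, with an error \<open>K * s\<^sup>2\<close>
  uniform in \<open>t\<close>, and then integrated. This rests on a fundamental theorem of calculus
  for Lipschitz functions. The comparison also divides by \<open>sin \<rho>\<close>, so the value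
  \<open>\<rho> = pi\<close> has to be excluded beforehand.\<close>

lemma lipschitz_real_homeo_density:
  fixes h :: "real \<Rightarrow> real"
  assumes lip: "L-lipschitz_on UNIV h" and exp: "\<And>x y. x \<le> y \<Longrightarrow> y - x \<le> h y - h x"
  obtains g where "g \<in> borel_measurable borel" "\<And>x. 0 \<le> g x"
    "\<And>a b. a \<le> b \<Longrightarrow> (g has_integral (h b - h a)) {a..b}"
proof -
  have sm: "strict_mono h"
    using exp by (intro strict_monoI) (smt (verit))
  have cont: "continuous_on UNIV h" using lip lipschitz_on_continuous_on by blast
  have surj: "\<exists>x. h x = y" for y
  proof -
    define B where "B = \<bar>y - h 0\<bar>"
    have "h (- B) \<le> y" "y \<le> h B" using exp[of "-B" 0] exp[of 0 B] unfolding B_def by linarith+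
    then show ?thesis
      using IVT'[of h "-B" y B] continuous_on_subset[OF cont] unfolding B_def by auto
  qed
  define k where "k = inv h"
  have hk: "h (k y) = y" for y using surj[of y] by (metis k_def f_inv_into_f rangeI)
  have kh: "k (h x) = x" for x using sm by (simp add: k_def strict_mono_imp_inj_on)
  have kmono: "mono k"
    by (rule monoI) (metis hk sm strict_mono_less_eq)
  have kmeas: "k \<in> borel_measurable borel" using kmono by (rule borel_measurable_mono)
  \<comment> \<open>\<open>N\<close> maps an interval to the length of its image under \<open>h\<close>; \<open>g\<close> is its Radon-Nikodym density.\<close>
  define N where "N = distr lborel borel k"
  have vim: "k -` A = h ` A" for A using hk kh by (auto simp: image_iff) metis
  \<comment> \<open>The preimage of a set under \<open>k\<close> is its image under
    \<open>h\<close>, and a Lipschitz map of the line sends null sets to null sets.\<close>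
  have ac: "absolutely_continuous lborel N"
    unfolding absolutely_continuous_def
  proof
    fix A assume A: "A \<in> null_sets (lborel::real measure)"
    have neg: "negligible (h ` A)"
    proof (rule negligible_locally_Lipschitz_image)
      show "negligible A" using A by (simp add: negligible_iff_null_sets null_sets_completionI)
    next
      fix x assume "x \<in> A"
      then show "\<exists>T B. open T \<and> x \<in> T \<and> (\<forall>y\<in>A \<inter> T. norm (h y - h x) \<le> B * norm (y - x))"
        using lip by (intro exI[of _ UNIV] exI[of _ L]) (auto simp: lipschitz_on_def dist_norm)
    qed simp
    have mA: "A \<in> sets borel" using A by auto
    have "k -` A \<inter> space borel \<in> sets borel" using kmeas mA by (rule measurable_sets)
    then have "h ` A \<in> sets borel" by (simp add: vim)
    then have "emeasure lborel (h ` A) = 0"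
      using neg by (simp add: negligible_iff_emeasure0)
    then have "emeasure N A = 0"
      unfolding N_def using kmeas mA by (subst emeasure_distr) (auto simp: vim)
    then show "A \<in> null_sets N" using mA by (auto simp: null_sets_def N_def)
  qed
  obtain f where f: "f \<in> borel_measurable lborel" "density lborel f = N"
    using sigma_finite_measure.Radon_Nikodym[OF sigma_finite_lborel ac] by (auto simp: N_def)
  have int: "(\<integral>\<^sup>+x\<in>{a..b}. f x \<partial>lborel) = ennreal (h b - h a)" if "a \<le> b" for a b
  proof -
    have "(\<integral>\<^sup>+x\<in>{a..b}. f x \<partial>lborel) = emeasure N {a..b}"
      using f by (subst f(2)[symmetric]) (subst emeasure_density, auto)
    also have "\<dots> = emeasure lborel (h ` {a..b})"
      unfolding N_def using kmeas by (subst emeasure_distr) (auto simp: vim)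
    also have "h ` {a..b} = {h a..h b}"
    proof -
      have "y \<in> h ` {a..b}" if "y \<in> {h a..h b}" for y
        using that hk[of y] kmono[THEN monoD, of "h a" y] kmono[THEN monoD, of y "h b"]
        by (intro image_eqI[of _ _ "k y"]) (auto simp: kh)
      then show ?thesis using sm by (auto simp: strict_mono_less_eq)
    qed
    finally show ?thesis using that sm by (simp add: strict_mono_less_eq)
  qed
  define g where "g = (\<lambda>x. enn2real (f x))"
  have fin: "AE x in lborel. f x \<noteq> \<infinity>"
  proof -
    have "AE x in lborel. \<forall>n::nat. x \<in> {-real n..real n} \<longrightarrow> f x \<noteq> \<infinity>"
    proof (rule AE_all_countable[THEN iffD2], rule)
      fix n :: nat
      have "(\<integral>\<^sup>+x\<in>{-real n..real n}. f x \<partial>lborel) \<noteq> \<infinity>" using int[of "-real n" "real n"] by auto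
      then have "AE x in lborel. f x * indicator {-real n..real n} x \<noteq> \<infinity>"
        using f by (intro nn_integral_PInf_AE) auto
      then show "AE x in lborel. x \<in> {-real n..real n} \<longrightarrow> f x \<noteq> \<infinity>"
        by eventually_elim auto
    qed
    then show ?thesis
    proof eventually_elim
      case (elim x)
      obtain n :: nat where "\<bar>x\<bar> \<le> real n" using real_arch_simple by blast
      then show ?case using elim by (auto simp: abs_le_iff)
    qed
  qed
  show ?thesis
  proof
    show gm: "g \<in> borel_measurable borel" using f by (simp add: g_def)
    show "0 \<le> g x" for x by (simp add: g_def)
    fix a b :: real assume ab: "a \<le> b"
    have "(\<integral>\<^sup>+x. ennreal (g x * indicator {a..b} x) \<partial>lborel) = (\<integral>\<^sup>+x\<in>{a..b}. f x \<partial>lborel)"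
      using fin by (intro nn_integral_cong_AE)
        (auto simp: g_def indicator_def less_top elim!: eventually_mono)
    then have "(\<integral>\<^sup>+x. ennreal (g x * indicator {a..b} x) \<partial>lborel) = ennreal (h b - h a)"
      using int[OF ab] by simp
    then have "((\<lambda>x. g x * indicator {a..b} x) has_integral (h b - h a)) UNIV"
      using gm ab sm by (intro nn_integral_has_integral) (auto simp: g_def strict_mono_less_eq)
    moreover have "(\<lambda>x. g x * indicator {a..b} x) = (\<lambda>x. if x \<in> {a..b} then g x else 0)"
      by (auto simp: indicator_def)
    ultimately show "(g has_integral (h b - h a)) {a..b}"
      by (simp only: has_integral_restrict_UNIV)
  qed
qed

text \<open>Lebesgue differentiation over boxes with corner \<open>x\<close>. On the line these are
  the intervals \<open>{x..x + h}\<close>, which explains why only the right derivative appears; the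
  left one comes by reflection in \<open>lipschitz_FTC\<close>.\<close>

lemma right_difference_quotient_AE:
  fixes f g :: "real \<Rightarrow> real"
  assumes int: "\<And>a b. a \<le> b \<Longrightarrow> (g has_integral (f b - f a)) {a..b}"
  obtains N where "negligible N"
    "\<And>x. x \<notin> N \<Longrightarrow> (f has_real_derivative g x) (at_right x)"
proof -
  have "g integrable_on cbox a b" for a b
    using int[of a b] by (cases "a \<le> b") auto
  then obtain N where N: "negligible N"
    "\<And>x e. \<lbrakk>x \<notin> N; 0 < e\<rbrakk> \<Longrightarrow> \<exists>d>0. \<forall>h. 0 < h \<and> h < d \<longrightarrow>
       norm (integral (cbox x (x + h *\<^sub>R One)) g /\<^sub>R h ^ DIM(real) - g x) < e"
    using integrable_ccontinuous_explicit by metis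
  show ?thesis
  proof
    show "negligible N" by fact
    fix x assume x: "x \<notin> N"
    have "((\<lambda>y. (f y - f x) / (y - x)) \<longlongrightarrow> g x) (at_right x)"
    proof (rule tendstoI)
      fix e :: real assume "0 < e"
      obtain d where d: "d > 0" "\<And>h. 0 < h \<and> h < d \<Longrightarrow>
          norm (integral (cbox x (x + h *\<^sub>R One)) g /\<^sub>R h ^ DIM(real) - g x) < e"
        using N(2)[OF x \<open>0 < e\<close>] by blast
      have "dist ((f y - f x) / (y - x)) (g x) < e" if "y \<in> {x<..<x+d}" for y
        using d(2)[of "y - x"] int[of x y, THEN integral_unique] that
        by (auto simp: dist_norm divide_simps)
      then show "\<forall>\<^sub>F y in at_right x. dist ((f y - f x) / (y - x)) (g x) < e"
        unfolding eventually_at_right_field using d(1) by (intro exI[of _ "x+d"]) auto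
    qed
    then show "(f has_real_derivative g x) (at_right x)"
      by (simp add: has_field_derivative_iff)
  qed
qed

lemma has_real_derivative_at_of_one_sided:
  assumes "(f has_real_derivative D) (at_right x)" "(f has_real_derivative D) (at_left x)"
  shows "(f has_real_derivative D) (at x)"
  using assms unfolding has_field_derivative_iff by (intro filterlim_split_at)

text \<open>Adding \<open>(C + 1) * x\<close> raises all slopes from at least \<open>- C\<close> to
  at least 1. The sum is still Lipschitz and becomes a homeomorphism of the line, so its increments
  have a Radon-Nikodym density; subtracting \<open>C + 1\<close> from that density gives the
  derivative of \<open>f\<close>.\<close>

lemma lipschitz_FTC:
  fixes f :: "real \<Rightarrow> real"
  assumes lip: "C-lipschitz_on UNIV f"
  obtains g N where "g \<in> borel_measurable borel" "negligible N"
    "\<And>x. x \<notin> N \<Longrightarrow> (f has_real_derivative g x) (at x)"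
    "\<And>a b. a \<le> b \<Longrightarrow> (g has_integral (f b - f a)) {a..b}"
proof -
  have C: "0 \<le> C" using lip lipschitz_on_nonneg by blast
  define h where "h x = f x + (C + 1) * x" for x
  have b: "\<bar>f y - f x\<bar> \<le> C * \<bar>y - x\<bar>" for x y
    using lip by (auto simp: lipschitz_on_def dist_norm)
  have "(C + (C + 1))-lipschitz_on UNIV h"
    unfolding h_def
    using lip C by (intro lipschitz_on_add) (auto simp: lipschitz_on_def dist_real_def abs_mult right_diff_distrib[symmetric])
  moreover have "y - x \<le> h y - h x" if "x \<le> y" for x y
  proof -
    have "- (C * (y - x)) \<le> f y - f x" using b[of y x] that by (simp add: abs_le_iff)
    then show ?thesis unfolding h_def by (simp add: algebra_simps)
  qed
  ultimately obtain g0 where g0: "g0 \<in> borel_measurable borel" "\<And>x. 0 \<le> g0 x"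
    "\<And>a b. a \<le> b \<Longrightarrow> (g0 has_integral (h b - h a)) {a..b}"
    using lipschitz_real_homeo_density[of "C + (C + 1)" h] by blast
  define g where "g x = g0 x - (C + 1)" for x
  have int: "(g has_integral (f b - f a)) {a..b}" if "a \<le> b" for a b
  proof -
    have "((\<lambda>x. g0 x - (C + 1)) has_integral ((h b - h a) - (b - a) * (C + 1))) {a..b}"
      using has_integral_diff[OF g0(3)[OF that] has_integral_const_real[of "C + 1" a b]] that by simp
    then show ?thesis unfolding g_def h_def by (simp add: algebra_simps)
  qed
  obtain N1 where N1: "negligible N1"
      "\<And>x. x \<notin> N1 \<Longrightarrow> (f has_real_derivative g x) (at_right x)"
    using right_difference_quotient_AE[OF int] by blast
  \<comment> \<open>Reflecting the line turns left derivatives of \<open>f\<close> into right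
    derivatives of \<open>f (- x)\<close>, to which the previous lemma applies again.\<close>
  have "((\<lambda>x. - g (- x)) has_integral (f (- b) - f (- a))) {a..b}" if "a \<le> b" for a b
    using has_integral_neg[OF has_integral_reflect_lemma_real[OF int[of "-b" "-a"]]] that by simp
  then obtain N2 where N2: "negligible N2"
      "\<And>x. x \<notin> N2 \<Longrightarrow> ((\<lambda>x. f (- x)) has_real_derivative - g (- x)) (at_right x)"
    using right_difference_quotient_AE[of "\<lambda>x. - g (- x)" "\<lambda>x. f (- x)"] by blast
  have left: "(f has_real_derivative g x) (at_left x)" if "- x \<notin> N2" for x
  proof -
    have "((\<lambda>x. f (- x)) has_real_derivative - g x) (at_right (- x))"
      using N2(2)[OF that] by simp
    then have "((\<lambda>y. (f (- y) - f x) / (y + x)) \<longlongrightarrow> - g x) (at_right (- x))"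
      by (simp add: has_field_derivative_iff)
    then have "((\<lambda>y. (f y - f x) / (- y + x)) \<longlongrightarrow> - g x) (at_left x)"
      by (simp add: at_right_minus filterlim_filtermap)
    then have "((\<lambda>y. - ((f y - f x) / (- y + x))) \<longlongrightarrow> g x) (at_left x)"
      using tendsto_minus by fastforce
    moreover have "- ((f y - f x) / (- y + x)) = (f y - f x) / (y - x)" for y
      by (metis add.commute minus_diff_eq minus_divide_right uminus_add_conv_diff)
    ultimately show ?thesis by (simp add: has_field_derivative_iff)
  qed
  show ?thesis
  proof
    show "g \<in> borel_measurable borel" unfolding g_def using g0 by simp
    have "negligible (uminus ` N2)"
      using N2(1) by (rule negligible_locally_Lipschitz_image[rotated])
        (auto intro!: exI[of _ "UNIV :: real set"] exI[of _ "1 :: real"] simp: abs_minus_commute)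
    then show "negligible (N1 \<union> uminus ` N2)" using N1 by auto
    show "(f has_real_derivative g x) (at x)" if "x \<notin> N1 \<union> uminus ` N2" for x
    proof (rule has_real_derivative_at_of_one_sided)
      have "- x \<notin> N2" using that image_eqI[of x uminus "- x" N2] by auto
      then show "(f has_real_derivative g x) (at_left x)" by (rule left)
    qed (use that N1(2) in auto)
    show "(g has_integral (f b - f a)) {a..b}" if "a \<le> b" for a b using int that .
  qed
qed

section \<open>The spherical distance\<close>

lemma sphere_dist_le_arccos:
  fixes x y :: "'a::euclidean_space"
  assumes dim: "2 \<le> DIM('a)" and x: "norm x = 1" and y: "norm y = 1"
  shows "sphere_dist x y \<le> ennreal (arccos (x \<bullet> y))"
proof -
  define R where "R = arccos (x \<bullet> y)"
  have xy: "\<bar>x \<bullet> y\<bar> \<le> 1" using Cauchy_Schwarz_ineq2[of x y] x y by simp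
  then have cosR: "cos R = x \<bullet> y" and R0: "0 \<le> R" "R \<le> pi"
    unfolding R_def by (auto simp: cos_arccos_abs intro!: arccos_lbound arccos_ubound)
  have sinR: "sin R ^ 2 = 1 - (x \<bullet> y)^2" using cosR by (simp add: sin_squared_eq)
  obtain e where e: "norm e = 1" "x \<bullet> e = 0" "y = cos R *\<^sub>R x + sin R *\<^sub>R e"
  proof (cases "sin R = 0")
    \<comment> \<open>Here \<open>y\<close> is \<open>x\<close> or \<open>- x\<close> and determines
      no direction; any unit vector orthogonal to \<open>x\<close> serves, and dimension at least 2
      provides one.\<close>
    case True
    obtain e0 where "e0 \<noteq> 0" "orthogonal x e0"
      using orthogonal_to_vector_exists[OF dim, of x] by metis
    define e where "e = e0 /\<^sub>R norm e0"
    have "norm (y - (x \<bullet> y) *\<^sub>R x) ^ 2 = 1 - (x \<bullet> y)^2"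
      using x y by (simp add: power2_norm_eq_inner algebra_simps inner_commute norm_eq_1)
        (simp add: power2_eq_square)
    then have "y = cos R *\<^sub>R x" using True sinR cosR by simp
    with \<open>e0 \<noteq> 0\<close> \<open>orthogonal x e0\<close> True show ?thesis
      by (intro that[of e]) (auto simp: e_def orthogonal_def)
  next
    case False
    define e where "e = (y - (x \<bullet> y) *\<^sub>R x) /\<^sub>R sin R"
    have sp: "sin R > 0" using False R0 sin_ge_zero[of R] by linarith
    have "norm (y - (x \<bullet> y) *\<^sub>R x) ^ 2 = (sin R)^2"
      unfolding sinR using x y by (simp add: power2_norm_eq_inner algebra_simps inner_commute norm_eq_1)
        (simp add: power2_eq_square)
    then have "norm (y - (x \<bullet> y) *\<^sub>R x) = sin R" using sp by (simp add: power2_eq_iff_nonneg)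
    then have "norm e = 1" using sp by (simp add: e_def)
    moreover have "x \<bullet> e = 0" using x by (simp add: e_def inner_diff_right norm_eq_1)
    ultimately show ?thesis using sp cosR by (intro that[of e]) (auto simp: e_def)
  qed
  define g where "g t = cos (R * t) *\<^sub>R x + sin (R * t) *\<^sub>R e" for t
  define g' where "g' t = (- sin (R * t) * R) *\<^sub>R x + (cos (R * t) * R) *\<^sub>R e" for t
  have d: "(g has_vector_derivative g' t) (at t)" for t
    unfolding g_def[abs_def] g'_def
    by (auto intro!: derivative_eq_intros has_vector_derivative_scaleR simp: has_real_derivative_iff_has_vector_derivative[symmetric])
  have n: "norm (a *\<^sub>R x + b *\<^sub>R e) ^ 2 = a^2 + b^2" for a b
    using x e by (simp add: power2_norm_eq_inner algebra_simps inner_commute norm_eq_1)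
      (simp add: power2_eq_square)
  have ng: "norm (g t) = 1" for t
  proof -
    have "norm (g t) ^ 2 = 1" unfolding g_def n by simp
    then show ?thesis by (metis norm_ge_zero one_power2 power2_eq_iff_nonneg zero_le_one)
  qed
  have ng': "norm (g' t) = R" for t
  proof -
    have "norm (g' t) ^ 2 = R^2 * ((sin (R*t))^2 + (cos (R*t))^2)"
      unfolding g'_def n by (simp add: power_mult_distrib algebra_simps del: sin_cos_squared_add sin_cos_squared_add2)
    then have "norm (g' t) ^ 2 = R^2" by simp
    then show ?thesis using R0 by (simp add: power2_eq_iff_nonneg)
  qed
  have "continuous_on {0..1} g'"
    unfolding g'_def by (intro continuous_intros)
  then have "g C1_differentiable_on {0..1}"
    unfolding C1_differentiable_on_def using d by (intro exI[of _ g']) auto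
  then have "valid_path g"
    by (simp add: valid_path_def C1_differentiable_imp_piecewise)
  moreover have "path_image g \<subseteq> sphere 0 1" using ng by (auto simp: path_image_def)
  moreover have "pathstart g = x" "pathfinish g = y"
    using e by (auto simp: pathstart_def pathfinish_def g_def)
  ultimately have "sphere_dist x y \<le> curve_length g"
    unfolding sphere_dist_def riemannian_dist_def by (intro INF_lower) auto
  also have "curve_length g = ennreal R"
    using d[THEN vector_derivative_at] ng' by (simp add: curve_length_def nn_integral_cmult_indicator)
  finally show ?thesis by (simp add: R_def)
qed

text \<open>The angle to the starting point \<open>x\<close> changes no faster than the curve moves:
  as the velocity is tangent to the sphere, it pairs only with the tangential part \<open>w\<close>
  of \<open>x\<close>, whose length \<open>sqrt (1 - (x \<bullet> g t)\<^sup>2)\<close> is what the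
  derivative of \<open>arccos\<close> divides by.\<close>

lemma curve_length_sphere_ge:
  fixes g :: "real \<Rightarrow> 'a::euclidean_space"
  assumes vp: "valid_path g" and im: "path_image g \<subseteq> sphere 0 1"
  shows "ennreal (arccos (pathstart g \<bullet> pathfinish g)) \<le> curve_length g"
proof (cases "curve_length g = \<infinity>")
  case False
  define x where "x = pathstart g"
  obtain S where S: "finite S" "g C1_differentiable_on {0..1} - S" and cg: "continuous_on {0..1} g"
    using vp by (auto simp: valid_path_def piecewise_C1_differentiable_on_def)
  define v where "v t = vector_derivative g (at t)" for t
  have d: "(g has_vector_derivative v t) (at t)" if "t \<in> {0..1} - S" for t
    using S that by (auto simp: C1_differentiable_on_eq v_def vector_derivative_works)
  have cv: "continuous_on ({0..1} - S) v"
    using S by (auto simp: C1_differentiable_on_eq v_def[abs_def])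
  have ng: "norm (g t) = 1" if "t \<in> {0..1}" for t
    using im that unfolding path_image_def by (metis image_subset_iff mem_sphere_0)
  then have nx: "norm x = 1" by (simp add: x_def pathstart_def)
  define L where "L = enn2real (curve_length g)"
  have L: "curve_length g = ennreal L" using False by (simp add: L_def less_top)
  \<comment> \<open>The factor \<open>1 - e\<close> keeps the argument away from \<open>\<plusminus>1\<close>, where \<open>arccos\<close> is not differentiable.\<close>
  have step: "arccos ((1 - e) * (x \<bullet> g 1)) - arccos (1 - e) \<le> L" if e: "0 < e" "e < 1" for e
  proof -
    define f where "f t = arccos ((1 - e) * (x \<bullet> g t))" for t
    define f' where "f' t = - ((1 - e) * (x \<bullet> v t)) / sqrt (1 - ((1 - e) * (x \<bullet> g t))\<^sup>2)" for t
    have small: "\<bar>(1 - e) * (x \<bullet> g t)\<bar> < 1" if "t \<in> {0..1}" for t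
    proof -
      have "\<bar>x \<bullet> g t\<bar> \<le> 1" using Cauchy_Schwarz_ineq2[of x "g t"] nx ng[OF that] by simp
      then have "(1 - e) * \<bar>x \<bullet> g t\<bar> \<le> 1 - e" using e by (intro mult_left_le) auto
      then have "(1 - e) * \<bar>x \<bullet> g t\<bar> < 1" using e by (meson diff_less_eq le_less_trans less_add_same_cancel1)
      then show ?thesis using e by (simp add: abs_mult)
    qed
    have fd: "(f has_vector_derivative f' t) (at t)" if "t \<in> {0..1} - S" for t
    proof -
      have "((\<lambda>t. (1 - e) * (x \<bullet> g t)) has_real_derivative (1 - e) * (x \<bullet> v t)) (at t)"
        unfolding has_real_derivative_iff_has_vector_derivative
        using bounded_linear.has_vector_derivative[OF bounded_linear_compose[OF bounded_linear_mult_right bounded_linear_inner_right] d[OF that]] .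
      then have "(f has_real_derivative inverse (- sqrt (1 - ((1 - e) * (x \<bullet> g t))\<^sup>2)) * ((1 - e) * (x \<bullet> v t))) (at t)"
        unfolding f_def[abs_def] using small[of t] that by (intro DERIV_chain2[OF DERIV_arccos]) auto
      then show ?thesis by (simp add: f'_def has_real_derivative_iff_has_vector_derivative divide_inverse mult.commute)
    qed
    have cf: "continuous_on {0..1} f"
      unfolding f_def using small by (intro continuous_intros cg) (auto simp: abs_less_iff less_imp_le)
    have FTC: "(f' has_integral (f 1 - f 0)) {0..1}"
      using fundamental_theorem_of_calculus_interior_strong[of S 0 1 f f'] S(1) cf fd by auto
    have bound: "\<bar>f' t\<bar> \<le> norm (v t)" if t: "t \<in> {0<..<1} - S" for t
    proof -
      let ?c = "x \<bullet> g t"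
      have t1: "t \<in> {0..1} - S" using t by auto
      have gv: "g t \<bullet> v t = 0"
      proof -
        have "((\<lambda>t. g t \<bullet> g t) has_real_derivative 2 * (g t \<bullet> v t)) (at t)"
          using d[OF t1] unfolding has_real_derivative_iff_has_vector_derivative has_vector_derivative_def
          by (auto intro!: derivative_eq_intros simp: inner_commute algebra_simps)
        moreover have "((\<lambda>t. g t \<bullet> g t) has_real_derivative 0) (at t)"
        proof (rule DERIV_cong_ev[THEN iffD1, OF refl _ refl])
          show "\<forall>\<^sub>F u in nhds t. (1::real) = g u \<bullet> g u"
            using t ng by (intro eventually_nhds[THEN iffD2] exI[of _ "{0<..<1}"]) (auto simp: norm_eq_1)
        qed simp
        ultimately show ?thesis using DERIV_unique by fastforce
      qed
      define w where "w = x - ?c *\<^sub>R g t"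
      have nw: "norm w = sqrt (1 - ?c\<^sup>2)"
        using nx ng[of t] t unfolding norm_eq_sqrt_inner w_def
        by (simp add: algebra_simps inner_commute power2_eq_square)
      have "\<bar>x \<bullet> v t\<bar> = \<bar>w \<bullet> v t\<bar>" using gv by (simp add: w_def inner_diff_left)
      also have "\<dots> \<le> sqrt (1 - ?c\<^sup>2) * norm (v t)" using Cauchy_Schwarz_ineq2[of w "v t"] nw by simp
      finally have 1: "\<bar>x \<bullet> v t\<bar> \<le> sqrt (1 - ?c\<^sup>2) * norm (v t)" .
      have "((1 - e) * ?c)\<^sup>2 \<le> ?c\<^sup>2"
        using e by (simp add: power_mult_distrib mult_left_le_one_le power_le_one)
      then have "sqrt (1 - ?c\<^sup>2) \<le> sqrt (1 - ((1 - e) * ?c)\<^sup>2)" by simp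
      then have "(1 - e) * \<bar>x \<bullet> v t\<bar> \<le> 1 * (sqrt (1 - ((1 - e) * ?c)\<^sup>2) * norm (v t))"
        using e by (intro mult_mono order_trans[OF 1 mult_right_mono[OF _ norm_ge_zero]]) auto
      moreover have "0 < sqrt (1 - ((1 - e) * ?c)\<^sup>2)"
        using small[of t] t by (simp add: abs_square_less_1)
      ultimately show ?thesis using e by (simp add: f'_def abs_mult divide_simps mult.commute)
    qed
    have mf': "(\<lambda>t. norm (v t) * indicator ({0..1} - S) t) \<in> borel_measurable borel"
    proof -
      have "{0..1} - S \<in> sets borel" using S(1) by (intro sets.Diff) (auto intro: finite_imp_closed borel_closed)
      moreover have "continuous_on ({0..1} - S) (\<lambda>t. norm (v t))" using cv by (intro continuous_intros)
      ultimately have "(\<lambda>t. indicator ({0..1} - S) t *\<^sub>R norm (v t)) \<in> borel_measurable borel"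
        by (rule borel_measurable_continuous_on_indicator)
      then show ?thesis by (simp add: mult.commute)
    qed
    have AEm: "AE t in lebesgue. t \<notin> S \<union> {0,1}"
      using S(1) by (intro AE_not_in) (auto intro: finite_imp_null_set_lborel null_sets_completionI)
    have nn: "(\<integral>\<^sup>+t. ennreal (norm (v t) * indicator ({0..1} - S) t) \<partial>lborel) = ennreal L"
    proof -
      have "(\<integral>\<^sup>+t. ennreal (norm (v t) * indicator ({0..1} - S) t) \<partial>lborel) =
          (\<integral>\<^sup>+t. ennreal (norm (v t) * indicator ({0..1} - S) t) \<partial>lebesgue)"
        using mf' by (intro nn_integral_completion[symmetric])
      also have "\<dots> = curve_length g"
        unfolding curve_length_def
      proof (rule nn_integral_cong_AE)
        show "AE t in lebesgue. ennreal (norm (v t) * indicator ({0..1} - S) t) =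
            ennreal (norm (vector_derivative g (at t))) * indicator {0..1} t"
          using AEm by eventually_elim (auto simp: v_def indicator_def)
      qed
      finally show ?thesis using L by simp
    qed
    have "((\<lambda>t. norm (v t) * indicator ({0..1} - S) t) has_integral L) UNIV"
      using nn mf' by (intro nn_integral_has_integral) (auto simp: L_def)
    moreover have "negligible (S \<union> {0,1})" using S(1) by (auto intro: negligible_finite)
    ultimately have "((\<lambda>t. if t \<in> {0..1} then norm (v t) else 0) has_integral L) UNIV"
      by (rule has_integral_spike[rotated 2, where S="S \<union> {0,1}"]) (auto simp: indicator_def)
    then have vI: "((\<lambda>t. norm (v t)) has_integral L) {0..1}"
      by (simp only: has_integral_restrict_UNIV)
    have "f 1 - f 0 \<le> L"
    proof (rule has_integral_le)
      let ?m = "\<lambda>t. if t \<in> S \<union> {0,1} then 0 else f' t"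
      show "(?m has_integral (f 1 - f 0)) {0..1}"
        by (rule has_integral_spike[OF \<open>negligible (S \<union> {0,1})\<close> _ FTC]) auto
      show "((\<lambda>t. norm (v t)) has_integral L) {0..1}" by fact
      show "?m t \<le> norm (v t)" if "t \<in> {0..1}" for t
        using bound[of t] that by auto
    qed
    then show ?thesis using nx by (simp add: f_def x_def pathstart_def norm_eq_1)
  qed
  have "((\<lambda>e. arccos ((1 - e) * (x \<bullet> g 1)) - arccos (1 - e)) \<longlongrightarrow> arccos ((1 - 0) * (x \<bullet> g 1)) - arccos (1 - 0)) (at_right 0)"
  proof -
    have c: "continuous_on {0..1} (\<lambda>e. arccos ((1 - e) * (x \<bullet> g 1)) - arccos (1 - e))"
    proof (intro continuous_intros ballI)
      fix e :: real assume e: "e \<in> {0..1}"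
      have "\<bar>x \<bullet> g 1\<bar> \<le> 1" using Cauchy_Schwarz_ineq2[of x "g 1"] nx ng[of 1] by simp
      then have "\<bar>(1 - e) * (x \<bullet> g 1)\<bar> \<le> 1" using e by (simp add: abs_mult mult_le_one)
      then show "- 1 \<le> (1 - e) * (x \<bullet> g 1) \<and> (1 - e) * (x \<bullet> g 1) \<le> 1" by (simp add: abs_le_iff)
    qed auto
    show ?thesis
      using continuous_on_Icc_at_rightD[OF c] by simp
  qed
  then have "((\<lambda>e. arccos ((1 - e) * (x \<bullet> g 1)) - arccos (1 - e)) \<longlongrightarrow> arccos (x \<bullet> g 1)) (at_right 0)"
    by simp
  then have "arccos (x \<bullet> g 1) \<le> L"
  proof (rule tendsto_upperbound[OF _ _ trivial_limit_at_right_real])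
    show "\<forall>\<^sub>F e in at_right 0. arccos ((1 - e) * (x \<bullet> g 1)) - arccos (1 - e) \<le> L"
      using step by (auto simp: eventually_at_right_field intro!: exI[of _ 1])
  qed
  then show ?thesis unfolding L by (simp add: x_def pathfinish_def ennreal_leI)
qed simp

lemma sphere_dist_eq_arccos:
  fixes x y :: "'a::euclidean_space"
  assumes "2 \<le> DIM('a)" "norm x = 1" "norm y = 1"
  shows "sphere_dist x y = ennreal (arccos (x \<bullet> y))"
proof (rule antisym)
  show "ennreal (arccos (x \<bullet> y)) \<le> sphere_dist x y"
    unfolding sphere_dist_def riemannian_dist_def
    using curve_length_sphere_ge by (intro INF_greatest) auto
qed (rule sphere_dist_le_arccos[OF assms])

text \<open>Distances are compared through their cosines, because \<open>x \<bullet> p\<close> is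
  linear in \<open>x\<close> and can be differentiated twice even where the distance is
  \<open>pi\<close> and \<open>arccos\<close> is not differentiable.\<close>

lemma cos_rho_ge:
  fixes N :: "'a::euclidean_space set"
  assumes "2 \<le> DIM('a)" "N \<subseteq> sphere 0 1" "norm x = 1" "p \<in> N"
  shows "rho N x \<le> pi" "x \<bullet> p \<le> cos (rho N x)"
proof -
  have p: "norm p = 1" using assms by auto
  have b: "\<bar>x \<bullet> p\<bar> \<le> 1" using Cauchy_Schwarz_ineq2[of x p] assms p by simp
  have "(INF y\<in>N. sphere_dist x y) \<le> ennreal (arccos (x \<bullet> p))"
    using assms p sphere_dist_eq_arccos by (metis INF_lower)
  then have 1: "rho N x \<le> arccos (x \<bullet> p)"
    unfolding rho_def using b by (intro enn2real_leI) (auto intro!: arccos_lbound)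
  moreover have "arccos (x \<bullet> p) \<le> pi" using b by (intro arccos_ubound) auto
  ultimately show "rho N x \<le> pi" by simp
  have "cos (arccos (x \<bullet> p)) \<le> cos (rho N x)"
    using 1 b by (intro cos_monotone_0_pi_le) (auto intro: arccos_ubound simp: rho_def)
  then show "x \<bullet> p \<le> cos (rho N x)" using b by (simp add: cos_arccos_abs)
qed

lemma rho_closest_point:
  fixes N :: "'a::euclidean_space set"
  assumes "2 \<le> DIM('a)" "N \<subseteq> sphere 0 1" "norm x = 1" "x \<notin> N" "is_closest_point N x p"
  shows "p \<in> N" "0 < rho N x" "cos (rho N x) = x \<bullet> p"
proof -
  show "p \<in> N" using assms by (simp add: is_closest_point_def)
  then have p: "norm p = 1" using assms by auto
  have b: "\<bar>x \<bullet> p\<bar> \<le> 1" using Cauchy_Schwarz_ineq2[of x p] assms p by simp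
  have "(INF z\<in>N. sphere_dist x z) = ennreal (arccos (x \<bullet> p))"
    using assms p sphere_dist_eq_arccos[of x p] by (simp add: is_closest_point_def)
  then have "rho N x = arccos (x \<bullet> p)"
    unfolding rho_def using b by (simp add: arccos_lbound abs_le_iff)
  then show c: "cos (rho N x) = x \<bullet> p" using b by (simp add: cos_arccos_abs)
  have "rho N x \<noteq> 0"
  proof
    assume "rho N x = 0"
    then have "x \<bullet> p = norm x * norm p" using c assms p by simp
    then have "x = p" using assms p by (metis norm_cauchy_schwarz_eq scaleR_one)
    then show False using \<open>p \<in> N\<close> assms by simp
  qed
  then show "0 < rho N x" by (simp add: rho_def less_le)
qed

section \<open>Gradient and Hessian of the distance to \<open>N\<close>\<close>

lemma second_derivative_test_min:
  fixes f f1 :: "real \<Rightarrow> real"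
  assumes d: "0 < d"
    and f: "\<And>t. \<bar>t\<bar> < d \<Longrightarrow> (f has_real_derivative f1 t) (at t)"
    and f1: "(f1 has_real_derivative D) (at 0)"
    and min: "\<And>t. \<bar>t\<bar> < d \<Longrightarrow> f 0 \<le> f t"
  shows "f1 0 = 0" "0 \<le> D"
proof -
  show f0: "f1 0 = 0"
    using DERIV_local_min[OF f d] d min by auto
  show "0 \<le> D"
  proof (rule ccontr)
    assume "\<not> 0 \<le> D"
    then obtain e where e: "0 < e" "\<And>h. 0 < h \<Longrightarrow> h < e \<Longrightarrow> f1 (0 + h) < f1 0"
      using DERIV_neg_dec_right[OF f1] by force
    define t where "t = min d e / 2"
    have t: "0 < t" "t < d" "t < e" using d e by (auto simp: t_def)
    obtain z where z: "0 < z" "z < t" "f t - f 0 = (t - 0) * f1 z"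
      using MVT2[OF t(1), of f f1] f t by force
    have "f1 z < 0" using e(2)[of z] z t f0 by simp
    then have "f t < f 0" using z t by (metis diff_less_0_iff_less diff_zero mult_pos_neg)
    then show False using min[of t] t by simp
  qed
qed

text \<open>This is \<open>R * cot R \<le> 1\<close> without the division. Through it the geometry
  of the sphere enters the Hessian bound for \<open>(rho N)\<^sup>2 / 2\<close>.\<close>

lemma mult_cos_le_sin:
  fixes R :: real
  assumes "0 \<le> R" "R \<le> pi"
  shows "R * cos R \<le> sin R"
proof -
  have "sin 0 - 0 * cos 0 \<le> sin R - R * cos R"
  proof (rule DERIV_nonneg_imp_nondecreasing[OF assms(1)])
    fix x assume x: "0 \<le> x" "x \<le> R"
    have "((\<lambda>x. sin x - x * cos x) has_real_derivative x * sin x) (at x)"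
      by (auto intro!: derivative_eq_intros)
    moreover have "0 \<le> x * sin x" using x assms by (intro mult_nonneg_nonneg sin_ge_zero) auto
    ultimately show "\<exists>y. ((\<lambda>x. sin x - x * cos x) has_real_derivative y) (at x) \<and> 0 \<le> y" by blast
  qed
  then show ?thesis by simp
qed

text \<open>\<open>F\<close> is an ambient extension of \<open>rho N\<close> and is controlled on
  the sphere only. Its normal derivative \<open>x \<bullet> grad x\<close> is therefore arbitrary,
  and has to be projected away at first order and compensated at second order.\<close>

locale smooth_rho_chart =
  fixes N W :: "'a::euclidean_space set" and F :: "'a \<Rightarrow> real"
    and F' :: "'a \<Rightarrow> 'a \<Rightarrow>\<^sub>L real" and F'' :: "'a \<Rightarrow> 'a \<Rightarrow>\<^sub>L ('a \<Rightarrow>\<^sub>L real)"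
  assumes dim: "2 \<le> DIM('a)" and N: "N \<subseteq> sphere 0 1" and W: "open W"
    and F': "x \<in> W \<Longrightarrow> (F has_derivative blinfun_apply (F' x)) (at x)"
    and F'': "x \<in> W \<Longrightarrow> (F' has_derivative blinfun_apply (F'' x)) (at x)"
    and cont: "continuous_on W F''"
    and F_rho: "x \<in> W \<Longrightarrow> norm x = 1 \<Longrightarrow> F x = rho N x"
    and closest: "x \<in> W \<Longrightarrow> norm x = 1 \<Longrightarrow> x \<notin> N \<and> (\<exists>p. is_closest_point N x p)"
begin

definition grad :: "'a \<Rightarrow> 'a" where "grad x = (\<Sum>b\<in>Basis. F' x b *\<^sub>R b)"
definition hess :: "'a \<Rightarrow> 'a \<Rightarrow> 'a" where "hess x w = (\<Sum>b\<in>Basis. F'' x w b *\<^sub>R b)"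
text \<open>\<open>sgrad\<close> is the gradient of \<open>rho N\<close> on the sphere, \<open>half_sq_grad\<close> that of \<open>(rho N)\<^sup>2 / 2\<close>, and \<open>half_sq_hess\<close> the
  derivative of \<open>half_sq_grad\<close> in the ambient space.\<close>

definition sgrad :: "'a \<Rightarrow> 'a" where "sgrad x = grad x - (x \<bullet> grad x) *\<^sub>R x"
definition half_sq_grad :: "'a \<Rightarrow> 'a" where "half_sq_grad x = F x *\<^sub>R sgrad x"
definition half_sq_hess :: "'a \<Rightarrow> 'a \<Rightarrow> 'a" where
  "half_sq_hess x w = (grad x \<bullet> w) *\<^sub>R sgrad x +
     F x *\<^sub>R (hess x w - (w \<bullet> grad x + x \<bullet> hess x w) *\<^sub>R x - (x \<bullet> grad x) *\<^sub>R w)"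

lemma F'_grad: "F' x w = grad x \<bullet> w"
proof -
  have "F' x w = F' x (\<Sum>b\<in>Basis. (w \<bullet> b) *\<^sub>R b)" by (simp add: euclidean_representation)
  then show ?thesis
    by (simp add: grad_def blinfun.sum_right blinfun.scaleR_right inner_sum_left inner_sum_right inner_commute mult.commute)
qed

lemma grad_derivative:
  assumes "x \<in> W" shows "(grad has_derivative hess x) (at x)"
  unfolding grad_def[abs_def] hess_def[abs_def]
  by (intro has_derivative_sum has_derivative_scaleR_left
      bounded_linear.has_derivative[OF blinfun.bounded_linear_left F''[OF assms]])

lemma F_derivative: "x \<in> W \<Longrightarrow> (F has_derivative (\<lambda>w. grad x \<bullet> w)) (at x)"
  using F'[of x] by (simp add: F'_grad[abs_def])

lemma half_sq_grad_derivative: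
  assumes "x \<in> W" shows "(half_sq_grad has_derivative half_sq_hess x) (at x)"
  unfolding half_sq_grad_def[abs_def] sgrad_def[abs_def]
  apply (rule has_derivative_eq_rhs)
   apply (rule derivative_intros F_derivative[OF assms] grad_derivative[OF assms])+
  apply (auto simp: fun_eq_iff half_sq_hess_def sgrad_def algebra_simps)
  done

text \<open>A great circle \<open>\<sigma>\<close> has acceleration \<open>- \<sigma>\<close>, so
  the second derivative of \<open>F\<close> along it is
  \<open>hess x w \<bullet> w - x \<bullet> grad x\<close>: the correction turns the ambient Hessian
  into that of \<open>rho N\<close> on the sphere. Where \<open>F x = pi\<close> the factor
  \<open>sin (F x)\<close> vanishes and the first conclusion says nothing about the gradient; there
  \<open>F\<close> has its largest possible value, which makes the derivative vanish.\<close>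

lemma great_circle_second_order:
  assumes x: "x \<in> W" "norm x = 1" and w: "norm w = 1" "x \<bullet> w = 0"
    and p: "is_closest_point N x p"
  shows "sin (F x) * (grad x \<bullet> w) = - (w \<bullet> p)"
    and "sin (F x) * (hess x w \<bullet> w - x \<bullet> grad x) \<le> cos (F x) * (1 - (grad x \<bullet> w)\<^sup>2)"
    and "F x = pi \<Longrightarrow> grad x \<bullet> w = 0"
proof -
  define \<sigma> where "\<sigma> t = cos t *\<^sub>R x + sin t *\<^sub>R w" for t
  define \<sigma>' where "\<sigma>' t = - sin t *\<^sub>R x + cos t *\<^sub>R w" for t
  have \<sigma>0: "\<sigma> 0 = x" "\<sigma>' 0 = w" by (auto simp: \<sigma>_def \<sigma>'_def)
  have d\<sigma>: "(\<sigma> has_vector_derivative \<sigma>' t) (at t)" for t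
    unfolding \<sigma>_def[abs_def] \<sigma>'_def
    by (auto intro!: derivative_eq_intros has_vector_derivative_scaleR simp: has_real_derivative_iff_has_vector_derivative[symmetric])
  have d\<sigma>': "(\<sigma>' has_vector_derivative - \<sigma> t) (at t)" for t
    unfolding \<sigma>_def[abs_def] \<sigma>'_def[abs_def]
    by (auto intro!: derivative_eq_intros has_vector_derivative_scaleR simp: has_real_derivative_iff_has_vector_derivative[symmetric])
  have n\<sigma>: "norm (\<sigma> t) = 1" for t
  proof -
    have "norm (\<sigma> t) ^ 2 = (cos t)^2 + (sin t)^2" unfolding \<sigma>_def
      using x w by (simp add: power2_norm_eq_inner inner_add_left inner_add_right inner_commute norm_eq_1)
    then have "norm (\<sigma> t) ^ 2 = 1" by simp
    then show ?thesis by (metis norm_ge_zero one_power2 power2_eq_iff_nonneg zero_le_one)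
  qed
  have "isCont \<sigma> 0" using d\<sigma> has_vector_derivative_continuous by blast
  then have "\<forall>\<^sub>F t in at 0. \<sigma> t \<in> W"
    using W x \<sigma>0 by (auto simp: isCont_def dest: topological_tendstoD)
  then obtain d where d: "0 < d" "\<And>t. \<bar>t\<bar> < d \<Longrightarrow> \<sigma> t \<in> W"
  proof -
    assume ev: "\<forall>\<^sub>F t in at 0. \<sigma> t \<in> W" and that: "\<And>d. 0 < d \<Longrightarrow> (\<And>t. \<bar>t\<bar> < d \<Longrightarrow> \<sigma> t \<in> W) \<Longrightarrow> thesis"
    obtain d where "0 < d" "\<And>t. t \<noteq> 0 \<Longrightarrow> dist t 0 < d \<Longrightarrow> \<sigma> t \<in> W"
      using ev by (auto simp: eventually_at)
    then show thesis using x \<sigma>0 that[of d] by (metis dist_real_def diff_zero)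
  qed
  have dF: "((\<lambda>t. F (\<sigma> t)) has_real_derivative (grad (\<sigma> t) \<bullet> \<sigma>' t)) (at t)" if "\<bar>t\<bar> < d" for t
  proof -
    have "((F \<circ> \<sigma>) has_derivative ((\<lambda>w. grad (\<sigma> t) \<bullet> w) \<circ> (\<lambda>h. h *\<^sub>R \<sigma>' t))) (at t)"
      using d\<sigma>[of t] F_derivative[OF d(2)[OF that]]
      by (intro diff_chain_at) (auto simp: has_vector_derivative_def)
    then have "((\<lambda>t. F (\<sigma> t)) has_derivative (\<lambda>h. h * (grad (\<sigma> t) \<bullet> \<sigma>' t))) (at t)"
      by (simp add: o_def)
    then show ?thesis by (simp add: has_field_derivative_def mult_commute_abs)
  qed
  \<comment> \<open>\<open>cos (F (\<sigma> t)) - \<sigma> t \<bullet> p\<close> is nonnegative and vanishes at \<open>0\<close>, because \<open>p\<close> is a closest point to \<open>x\<close>.\<close>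
  define f1 where "f1 t = - sin (F (\<sigma> t)) * (grad (\<sigma> t) \<bullet> \<sigma>' t) - \<sigma>' t \<bullet> p" for t
  have d1: "((\<lambda>t. cos (F (\<sigma> t)) - \<sigma> t \<bullet> p) has_real_derivative f1 t) (at t)" if "\<bar>t\<bar> < d" for t
  proof -
    have "((\<lambda>t. \<sigma> t \<bullet> p) has_real_derivative \<sigma>' t \<bullet> p) (at t)"
      unfolding has_real_derivative_iff_has_vector_derivative
      by (rule bounded_linear.has_vector_derivative[OF bounded_linear_inner_left d\<sigma>])
    then show ?thesis unfolding f1_def using dF[OF that] by (auto intro!: derivative_eq_intros)
  qed
  define D where "D = - cos (F x) * (grad x \<bullet> w)\<^sup>2 - sin (F x) * (hess x w \<bullet> w - x \<bullet> grad x) + x \<bullet> p"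
  have d2: "(f1 has_real_derivative D) (at 0)"
  proof -
    have "((grad \<circ> \<sigma>) has_derivative (hess x \<circ> (\<lambda>h. h *\<^sub>R w))) (at 0)"
      using d\<sigma>[of 0] grad_derivative[OF x(1)] \<sigma>0
      by (intro diff_chain_at) (auto simp: has_vector_derivative_def)
    moreover have "linear (hess x)" using grad_derivative[OF x(1)] has_derivative_linear by blast
    ultimately have g: "((\<lambda>t. grad (\<sigma> t)) has_vector_derivative hess x w) (at 0)"
      by (simp add: o_def has_vector_derivative_def linear_scale)
    have "((\<lambda>t. grad (\<sigma> t) \<bullet> \<sigma>' t) has_real_derivative (hess x w \<bullet> w - x \<bullet> grad x)) (at 0)"
      using has_derivative_inner[OF g[unfolded has_vector_derivative_def] d\<sigma>'[of 0, unfolded has_vector_derivative_def]]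
      by (simp add: has_field_derivative_def \<sigma>0 inner_commute algebra_simps)
        (simp add: right_diff_distrib[symmetric] mult_commute_abs)
    moreover have "((\<lambda>t. \<sigma>' t \<bullet> p) has_real_derivative - x \<bullet> p) (at 0)"
      unfolding has_real_derivative_iff_has_vector_derivative
      using bounded_linear.has_vector_derivative[OF bounded_linear_inner_left d\<sigma>'[of 0]] \<sigma>0 by simp
    ultimately show ?thesis unfolding f1_def[abs_def] D_def using dF[of 0] d
      by (auto intro!: derivative_eq_intros simp: \<sigma>0 power2_eq_square)
  qed
  have cl: "p \<in> N" "cos (rho N x) = x \<bullet> p" "0 < rho N x"
    using rho_closest_point[OF dim N x(2) _ p] closest[OF x] by auto
  have "cos (F (\<sigma> t)) - \<sigma> t \<bullet> p \<ge> 0" if "\<bar>t\<bar> < d" for t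
    using cos_rho_ge(2)[OF dim N n\<sigma> cl(1)] F_rho[OF d(2)[OF that] n\<sigma>] by simp
  moreover have "cos (F (\<sigma> 0)) - \<sigma> 0 \<bullet> p = 0" using cl F_rho[OF x] \<sigma>0 by simp
  ultimately have "f1 0 = 0" "0 \<le> D"
    using second_derivative_test_min[OF d(1) d1 d2] by auto
  \<comment> \<open>Replacing the term \<open>x \<bullet> p\<close> of \<open>D\<close> by
    \<open>cos (F x)\<close> produces the factor
    \<open>1 - (grad x \<bullet> w)\<^sup>2\<close>.\<close>
  then show "sin (F x) * (grad x \<bullet> w) = - (w \<bullet> p)"
    and "sin (F x) * (hess x w \<bullet> w - x \<bullet> grad x) \<le> cos (F x) * (1 - (grad x \<bullet> w)\<^sup>2)"
    using cl F_rho[OF x] by (auto simp: f1_def D_def \<sigma>0 algebra_simps)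
  show "grad x \<bullet> w = 0" if "F x = pi"
  proof -
    have "F (\<sigma> t) \<le> F (\<sigma> 0)" if "\<bar>t\<bar> < d" for t
      using cos_rho_ge(1)[OF dim N n\<sigma> cl(1)] F_rho[OF d(2)[OF that] n\<sigma>] \<sigma>0 \<open>F x = pi\<close> by simp
    then show ?thesis using DERIV_local_max[OF dF[of 0] d(1)] d \<sigma>0 by auto
  qed
qed

lemma F_bounds:
  assumes x: "x \<in> W" "norm x = 1"
  shows "0 < F x" "F x < pi"
proof -
  obtain p where p: "is_closest_point N x p" "x \<notin> N" using closest[OF x] by blast
  note cl = rho_closest_point[OF dim N x(2) p(2) p(1)]
  show "0 < F x" using cl F_rho[OF x] by simp
  obtain e where e: "e \<noteq> 0" "orthogonal x e" using orthogonal_to_vector_exists[OF dim, of x] by metis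
  define w where "w = e /\<^sub>R norm e"
  have w: "norm w = 1" "x \<bullet> w = 0" using e by (auto simp: w_def orthogonal_def)
  \<comment> \<open>At \<open>F x = pi\<close> the derivative along \<open>w\<close> is 0, and the
    second-order inequality would read \<open>0 \<le> - 1\<close>.\<close>
  have "F x \<noteq> pi"
    using great_circle_second_order(2,3)[OF x w p(1)] by auto
  then show "F x < pi" using cos_rho_ge(1)[OF dim N x(2) cl(1)] F_rho[OF x] by simp
qed

lemma sgrad_tangent: "norm x = 1 \<Longrightarrow> x \<bullet> sgrad x = 0"
  by (simp add: sgrad_def inner_diff_right norm_eq_1)

lemma sgrad_inner: "x \<bullet> w = 0 \<Longrightarrow> sgrad x \<bullet> w = grad x \<bullet> w"
  by (simp add: sgrad_def inner_diff_left)

text \<open>The first-order condition says that \<open>sin (F x) *\<^sub>R sgrad x\<close> is minus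
  the tangential part \<open>q\<close> of \<open>p\<close>, and \<open>q\<close> has length
  \<open>sin (F x)\<close>. Testing the condition with \<open>q\<close> and then with
  \<open>sgrad x\<close> itself avoids proving the vector identity.\<close>

lemma norm_sgrad:
  assumes x: "x \<in> W" "norm x = 1"
  shows "norm (sgrad x) = 1"
proof -
  obtain p where p: "is_closest_point N x p" "x \<notin> N" using closest[OF x] by blast
  note cl = rho_closest_point[OF dim N x(2) p(2) p(1)]
  have s: "0 < sin (F x)" using F_bounds[OF x] sin_gt_zero by blast
  have lin: "sin (F x) * (grad x \<bullet> w) = - (w \<bullet> p)" if "x \<bullet> w = 0" for w
  proof (cases "w = 0")
    case False
    then show ?thesis
      using great_circle_second_order(1)[OF x _ _ p(1), of "w /\<^sub>R norm w"] that by (simp add: divide_simps)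
  qed simp
  define q where "q = p - cos (F x) *\<^sub>R x"
  have xp: "x \<bullet> p = cos (F x)" using cl F_rho[OF x] by simp
  have xx: "x \<bullet> x = 1" using x by (simp add: norm_eq_1)
  have pp: "p \<bullet> p = 1" using cl N by (auto simp: norm_eq_1[symmetric])
  have xq: "x \<bullet> q = 0" using xp xx by (simp add: q_def inner_diff_right)
  have qp: "q \<bullet> p = (sin (F x))\<^sup>2"
    using xp pp by (simp add: q_def inner_diff_left sin_squared_eq) (simp add: power2_eq_square)
  have tan: "x \<bullet> sgrad x = 0" using sgrad_tangent x by blast
  have "sin (F x) * (grad x \<bullet> q) = sin (F x) * (- sin (F x))"
    using lin[OF xq] qp by (simp add: power2_eq_square)
  then have "grad x \<bullet> q = - sin (F x)" using s by (metis less_irrefl mult_cancel_left)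
  then have gq: "sgrad x \<bullet> q = - sin (F x)" using sgrad_inner[OF xq] by simp
  have "sgrad x \<bullet> p = sgrad x \<bullet> q" using tan by (simp add: q_def inner_diff_right inner_commute)
  then have "sin (F x) * (sgrad x \<bullet> sgrad x) = sin (F x) * 1"
    using lin[OF tan] gq sgrad_inner[OF tan] by simp
  then show ?thesis using s by (simp add: norm_eq_1)
qed

text \<open>On a unit tangent vector \<open>u\<close> the form is \<open>m + F x * h\<close>, where
  \<open>m\<close> is the squared derivative of \<open>rho N\<close> and \<open>h\<close> its
  Hessian on the sphere. Since \<open>h\<close> is at most \<open>cot (F x) * (1 - m)\<close> and
  \<open>F x * cot (F x) \<le> 1\<close>, the sum is at most 1; the sign of \<open>1 - m\<close>
  comes from \<open>norm_sgrad\<close>.\<close>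

lemma half_sq_hess_inner_le:
  assumes x: "x \<in> W" "norm x = 1" and w: "x \<bullet> w = 0"
  shows "half_sq_hess x w \<bullet> w \<le> norm w ^ 2"
proof (cases "w = 0")
  case False
  obtain p where p: "is_closest_point N x p" "x \<notin> N" using closest[OF x] by blast
  have s: "0 < sin (F x)" using F_bounds[OF x] sin_gt_zero by blast
  have unit: "half_sq_hess x u \<bullet> u \<le> 1" if u: "norm u = 1" "x \<bullet> u = 0" for u
  proof -
    define m where "m = (grad x \<bullet> u)\<^sup>2"
    define h where "h = hess x u \<bullet> u - x \<bullet> grad x"
    have "half_sq_hess x u \<bullet> u = m + F x * h"
      using u by (simp add: half_sq_hess_def m_def h_def sgrad_inner inner_add_left inner_diff_left power2_eq_square norm_eq_1)
    moreover have m: "m \<le> 1"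
    proof -
      have "\<bar>sgrad x \<bullet> u\<bar> \<le> 1"
        using Cauchy_Schwarz_ineq2[of "sgrad x" u] norm_sgrad[OF x] u by simp
      then show ?thesis unfolding m_def using sgrad_inner[OF u(2)] by (simp add: abs_square_le_1)
    qed
    moreover have "F x * h \<le> 1 - m"
    proof -
      have "sin (F x) * h \<le> cos (F x) * (1 - m)"
        using great_circle_second_order(2)[OF x u p(1)] by (simp add: m_def h_def)
      then have "F x * (sin (F x) * h) \<le> F x * (cos (F x) * (1 - m))"
        using F_bounds[OF x] by (intro mult_left_mono) auto
      also have "\<dots> = (F x * cos (F x)) * (1 - m)" by simp
      also have "\<dots> \<le> sin (F x) * (1 - m)"
        using m mult_cos_le_sin[of "F x"] F_bounds[OF x] by (intro mult_right_mono) auto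
      finally have "sin (F x) * (F x * h) \<le> sin (F x) * (1 - m)" by (simp add: mult_ac)
      then show ?thesis using s by simp
    qed
    ultimately show ?thesis by linarith
  qed
  have lin: "linear (half_sq_hess x)" using half_sq_grad_derivative[OF x(1)] has_derivative_linear by blast
  have "half_sq_hess x (w /\<^sub>R norm w) \<bullet> (w /\<^sub>R norm w) \<le> 1"
    using w False by (intro unit) auto
  then show ?thesis
    using False by (simp add: linear_scale[OF lin] divide_simps power2_eq_square)
qed (simp add: half_sq_hess_def)

end

section \<open>Pushing a curve away from \<open>N\<close>\<close>

context smooth_rho_chart
begin

lemma linear_hess: "x \<in> W \<Longrightarrow> linear (hess x)"
  using grad_derivative has_derivative_linear by blast

lemma linear_DX: "x \<in> W \<Longrightarrow> linear (half_sq_hess x)"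
  using half_sq_grad_derivative has_derivative_linear by blast

text \<open>Continuity of the second derivative on a compact ball. A common \<open>B\<close> is what
  later makes the error term \<open>K * s\<^sup>2\<close> uniform along the curve.\<close>

lemma local_bounds:
  assumes "x0 \<in> W"
  obtains \<delta> B where "0 < \<delta>" "cball x0 \<delta> \<subseteq> W" "0 \<le> B"
    "\<And>x. x \<in> cball x0 \<delta> \<Longrightarrow> norm (grad x) \<le> B"
    "\<And>x w. x \<in> cball x0 \<delta> \<Longrightarrow> norm (hess x w) \<le> B * norm w"
    "\<And>x w. x \<in> cball x0 \<delta> \<Longrightarrow> norm (half_sq_hess x w) \<le> B * norm w"
proof -
  obtain \<delta> where \<delta>: "0 < \<delta>" "cball x0 \<delta> \<subseteq> W"
    using W assms open_contains_cball by blast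
  have cg: "continuous_on W grad"
    using has_derivative_continuous[OF grad_derivative] by (auto intro!: continuous_at_imp_continuous_on)
  have cF: "continuous_on W F"
    using has_derivative_continuous[OF F_derivative] by (auto intro!: continuous_at_imp_continuous_on)
  have ch: "continuous_on W (\<lambda>x. hess x b)" for b
    unfolding hess_def by (intro continuous_intros cont)
  have cs: "continuous_on W sgrad"
    unfolding sgrad_def[abs_def] by (intro continuous_intros cg)
  have cD: "continuous_on W (\<lambda>x. half_sq_hess x b)" for b
    unfolding half_sq_hess_def by (intro continuous_intros cg ch cs cF)
  have bd: "norm (L w) \<le> (\<Sum>b\<in>Basis. norm (L b)) * norm w" if "linear L" for L :: "'a \<Rightarrow> 'a" and w
  proof -
    have "L w = (\<Sum>b\<in>Basis. (w \<bullet> b) *\<^sub>R L b)"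
      using linear_sum[OF that] linear_scale[OF that]
      by (metis (no_types, lifting) euclidean_representation sum.cong)
    also have "norm \<dots> \<le> (\<Sum>b\<in>Basis. norm w * norm (L b))"
      by (intro sum_norm_le) (simp add: mult_right_mono Basis_le_norm)
    finally show ?thesis by (simp add: sum_distrib_left[symmetric] mult.commute)
  qed
  define f where "f x = norm (grad x) + (\<Sum>b\<in>Basis. norm (hess x b)) + (\<Sum>b\<in>Basis. norm (half_sq_hess x b))" for x
  have "continuous_on W f"
    unfolding f_def by (intro continuous_intros cg ch cD)
  then have "compact (f ` cball x0 \<delta>)"
    using \<delta> by (intro compact_continuous_image) (auto intro: continuous_on_subset)
  then obtain B where B: "\<And>x. x \<in> cball x0 \<delta> \<Longrightarrow> norm (f x) \<le> B"
    using compact_imp_bounded[THEN bounded_iff[THEN iffD1]] by (meson imageI)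
  have nn: "0 \<le> norm (grad x)" "0 \<le> (\<Sum>b\<in>Basis. norm (hess x b))" "0 \<le> (\<Sum>b\<in>Basis. norm (half_sq_hess x b))" for x
    by (auto intro: sum_nonneg)
  have le: "norm (grad x) \<le> B" "(\<Sum>b\<in>Basis. norm (hess x b)) \<le> B" "(\<Sum>b\<in>Basis. norm (half_sq_hess x b)) \<le> B"
    if "x \<in> cball x0 \<delta>" for x
    using B[OF that] nn[of x] unfolding f_def real_norm_def by linarith+
  show ?thesis
  proof
    show "0 \<le> B" using le(1)[of x0] \<delta> norm_ge_zero[of "grad x0"] by (simp del: norm_ge_zero)
    fix x w assume x: "x \<in> cball x0 \<delta>"
    then have "x \<in> W" using \<delta> by auto
    show "norm (hess x w) \<le> B * norm w"
      by (rule order_trans[OF bd[OF linear_hess[OF \<open>x \<in> W\<close>]] mult_right_mono[OF le(2)[OF x]]]) simp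
    show "norm (half_sq_hess x w) \<le> B * norm w"
      by (rule order_trans[OF bd[OF linear_DX[OF \<open>x \<in> W\<close>]] mult_right_mono[OF le(3)[OF x]]]) simp
  qed (use \<delta> le in auto)
qed

text \<open>Mean value theorem on the segment, which stays in the convex ball, together with the
  \<open>B\<close>-Lipschitz bound for the gradient. This gives the constant \<open>B\<close> where
  \<open>B / 2\<close> would be sharp.\<close>

lemma F_lower_taylor:
  assumes sub: "cball x0 \<delta> \<subseteq> W" and B: "0 \<le> B"
    and h: "\<And>x w. x \<in> cball x0 \<delta> \<Longrightarrow> norm (hess x w) \<le> B * norm w"
    and x: "x \<in> cball x0 \<delta>" and y: "y \<in> cball x0 \<delta>"
  shows "F x + grad x \<bullet> (y - x) - B * (norm (y - x))\<^sup>2 \<le> F y"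
proof -
  have g: "norm (grad z - grad x) \<le> B * norm (z - x)" if z: "z \<in> cball x0 \<delta>" for z
  proof (rule differentiable_bound[OF convex_cball _ _ z x])
    fix u assume u: "u \<in> cball x0 \<delta>"
    show "(grad has_derivative hess u) (at u within cball x0 \<delta>)"
      using grad_derivative u sub by (blast intro: has_derivative_at_withinI)
    show "onorm (hess u) \<le> B" by (rule onorm_le) (rule h[OF u])
  qed
  have seg: "x + t *\<^sub>R (y - x) \<in> cball x0 \<delta>" if "0 \<le> t" "t \<le> 1" for t
  proof -
    have "(1 - t) *\<^sub>R x + t *\<^sub>R y \<in> cball x0 \<delta>"
      using convexD_alt[OF convex_cball x y] that by simp
    then show ?thesis by (simp add: algebra_simps)
  qed
  have d: "((\<lambda>t. F (x + t *\<^sub>R (y - x))) has_real_derivative grad (x + t *\<^sub>R (y - x)) \<bullet> (y - x)) (at t)"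
    if "0 \<le> t" "t \<le> 1" for t
  proof -
    have "((\<lambda>t. F (x + t *\<^sub>R (y - x))) has_derivative (\<lambda>h. grad (x + t *\<^sub>R (y - x)) \<bullet> (h *\<^sub>R (y - x)))) (at t)"
      by (rule has_derivative_compose[where f="\<lambda>t. x + t *\<^sub>R (y - x)", OF _ F_derivative])
        (use seg[OF that] sub in \<open>auto intro!: derivative_eq_intros\<close>)
    then show ?thesis by (simp add: has_field_derivative_def mult_commute_abs)
  qed
  obtain t where t: "0 < t" "t < 1" "F y - F x = grad (x + t *\<^sub>R (y - x)) \<bullet> (y - x)"
    using MVT2[of 0 1 "\<lambda>t. F (x + t *\<^sub>R (y - x))", OF _ d] by auto
  let ?z = "x + t *\<^sub>R (y - x)"
  have z: "?z \<in> cball x0 \<delta>" using seg[of t] t by simp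
  have "F y - F x - grad x \<bullet> (y - x) = (grad ?z - grad x) \<bullet> (y - x)"
    using t by (simp add: inner_diff_left)
  moreover have "\<bar>(grad ?z - grad x) \<bullet> (y - x)\<bar> \<le> B * (norm (y - x))\<^sup>2"
  proof -
    have "norm (grad ?z - grad x) \<le> B * norm (t *\<^sub>R (y - x))" using g[OF z] by simp
    also have "\<dots> \<le> B * norm (y - x)" using t B by (intro mult_left_mono) (auto intro: mult_left_le_one_le)
    finally have "norm (grad ?z - grad x) * norm (y - x) \<le> B * norm (y - x) * norm (y - x)"
      by (intro mult_right_mono) auto
    then show ?thesis using Cauchy_Schwarz_ineq2[of "grad ?z - grad x" "y - x"]
      by (simp add: power2_eq_square mult.assoc)
  qed
  ultimately show ?thesis by linarith
qed

text \<open>The field is tangent to the sphere, so the push leaves the open unit ball, and only by a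
  second-order amount. From \<open>F x < pi < 4\<close> the push has length at most
  \<open>4 * e\<close> and the radial projection moves by at most \<open>16 * e\<^sup>2\<close>,
  together at most \<open>20 * e\<close>; the assumption \<open>40 * e \<le> \<delta>\<close> makes
  this at most \<open>\<delta> / 2\<close>. The constant 416 is 16 for the projection plus
  \<open>20\<^sup>2\<close> for the Taylor remainder.\<close>

lemma pushed_point_bounds:
  assumes sub: "cball x0 \<delta> \<subseteq> W" and B: "0 \<le> B"
    and gb: "norm (grad x) \<le> B"
    and h: "\<And>x w. x \<in> cball x0 \<delta> \<Longrightarrow> norm (hess x w) \<le> B * norm w"
    and x: "x \<in> cball x0 (\<delta> / 2)" "norm x = 1" and e: "0 \<le> e" "e \<le> 1" "40 * e \<le> \<delta>"
    and y: "y = x + e *\<^sub>R half_sq_grad x"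
  shows "1 \<le> norm y" "sgn y \<in> cball x0 \<delta>"
    "F x * (1 + e) - 416 * B * e\<^sup>2 \<le> F (sgn y)"
proof -
  have \<delta>: "0 \<le> \<delta>" using e by linarith
  have x': "x \<in> cball x0 \<delta>" "x \<in> W" using x \<delta> sub by auto
  define r where "r = F x"
  have r: "0 < r" "r \<le> 4" using F_bounds[OF x'(2) x(2)] pi_less_4 by (auto simp: r_def)
  have nX: "norm (half_sq_grad x) = r" using norm_sgrad[OF x'(2) x(2)] r by (simp add: half_sq_grad_def r_def)
  have xX: "x \<bullet> half_sq_grad x = 0" using sgrad_tangent[OF x(2)] by (simp add: half_sq_grad_def)
  have ny: "(norm y)\<^sup>2 = 1 + (e * r)\<^sup>2"
  proof -
    have "(norm y)\<^sup>2 = (norm x)\<^sup>2 + (norm (e *\<^sub>R half_sq_grad x))\<^sup>2"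
      unfolding y using xX by (intro norm_add_Pythagorean) (simp add: orthogonal_def)
    then show ?thesis using x nX e by (simp add: power_mult_distrib)
  qed
  then show y1: "1 \<le> norm y"
    by (metis le_add_same_cancel1 norm_ge_zero one_power2 power2_le_imp_le zero_le_power2)
  have y2: "norm y - 1 \<le> (e * r)\<^sup>2"
  proof -
    have "(norm y - 1) * 1 \<le> (norm y - 1) * (norm y + 1)" using y1 by (intro mult_left_mono) auto
    also have "\<dots> = (e * r)\<^sup>2" using ny by (simp add: algebra_simps power2_eq_square)
    finally show ?thesis by simp
  qed
  have er: "(e * r)\<^sup>2 \<le> 16 * e\<^sup>2" "e * r \<le> 4 * e" "0 \<le> e * r"
  proof -
    show "e * r \<le> 4 * e" "0 \<le> e * r" using r e by (auto simp: mult.commute mult_left_mono)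
    then have "(e * r)\<^sup>2 \<le> (4 * e)\<^sup>2" by (intro power_mono) auto
    then show "(e * r)\<^sup>2 \<le> 16 * e\<^sup>2" by (simp add: power_mult_distrib)
  qed
  have cy: "norm (sgn y - y) = norm y - 1"
  proof -
    have "sgn y - y = (inverse (norm y) - 1) *\<^sub>R y" by (simp add: sgn_div_norm algebra_simps)
    then have "norm (sgn y - y) = \<bar>inverse (norm y) - 1\<bar> * norm y" by simp
    also have "\<dots> = (1 - inverse (norm y)) * norm y"
      using inverse_le_1_iff[of "norm y"] y1 by simp
    also have "\<dots> = norm y - 1"
    proof -
      have "norm y \<noteq> 0" using y1 by linarith
      then show ?thesis by (simp add: left_diff_distrib)
    qed
    finally show ?thesis .
  qed
  have "norm (sgn y - x) \<le> norm (sgn y - y) + norm (y - x)"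
    using norm_triangle_ineq[of "sgn y - y" "y - x"] by simp
  also have "norm (y - x) = e * r" using nX e by (simp add: y)
  finally have cx: "norm (sgn y - x) \<le> 20 * e"
  proof -
    assume "norm (sgn y - x) \<le> norm (sgn y - y) + e * r"
    moreover have "e\<^sup>2 \<le> e" using e by (simp add: power2_eq_square mult_left_le)
    ultimately show ?thesis using cy y2 er by linarith
  qed
  then have "dist x0 (sgn y) \<le> \<delta>"
    using dist_triangle[of x0 "sgn y" x] x e by (simp add: dist_norm norm_minus_commute)
  then show c: "sgn y \<in> cball x0 \<delta>" by simp
  have T: "F x + grad x \<bullet> (sgn y - x) - B * (norm (sgn y - x))\<^sup>2 \<le> F (sgn y)"
    by (rule F_lower_taylor[OF sub B h x'(1) c])
  have gx: "grad x \<bullet> (sgn y - x) = e * r + grad x \<bullet> (sgn y - y)"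
  proof -
    \<comment> \<open>\<open>sgrad x\<close> is the tangential part of \<open>grad x\<close> and has
      length 1; hence \<open>F\<close> grows along the push at the exact rate
      \<open>F x\<close>.\<close>
    have "grad x \<bullet> sgrad x = 1"
      using sgrad_inner[OF sgrad_tangent[OF x(2)]] norm_sgrad[OF x'(2) x(2)] by (simp add: norm_eq_1)
    then have "grad x \<bullet> (y - x) = e * r" by (simp add: y half_sq_grad_def r_def)
    then show ?thesis by (simp add: inner_diff_right)
  qed
  have "\<bar>grad x \<bullet> (sgn y - y)\<bar> \<le> B * (16 * e\<^sup>2)"
  proof -
    have "\<bar>grad x \<bullet> (sgn y - y)\<bar> \<le> norm (grad x) * norm (sgn y - y)" by (rule Cauchy_Schwarz_ineq2)
    also have "\<dots> \<le> B * (16 * e\<^sup>2)" using gb cy y1 y2 er B by (intro mult_mono) auto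
    finally show ?thesis .
  qed
  moreover have "B * (norm (sgn y - x))\<^sup>2 \<le> B * (20 * e)\<^sup>2"
    using cx B by (intro mult_left_mono power_mono) auto
  ultimately have "r + e * r - B * (16 * e\<^sup>2) - B * (20 * e)\<^sup>2 \<le> F (sgn y)"
    using T gx unfolding r_def by linarith
  then show "F x * (1 + e) - 416 * B * e\<^sup>2 \<le> F (sgn y)"
    by (simp add: r_def algebra_simps power_mult_distrib)
qed

text \<open>Only the term linear in \<open>s\<close> needs the sharp Hessian inequality, multiplied
  by \<open>\<eta> \<ge> 0\<close>; for the quadratic term the crude bound
  \<open>(M + B) * F x\<close> on the added vector suffices. The assumption
  \<open>norm v = F x\<close> is unit speed in the condition metric and lets
  \<open>(F x)\<^sup>2\<close> factor out.\<close>

lemma pushed_velocity_bound: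
  assumes B: "0 \<le> B" and M: "0 \<le> M"
    and Db: "norm (half_sq_hess x v) \<le> B * norm v"
    and x: "x \<in> W" "norm x = 1" and v: "x \<bullet> v = 0" "norm v = F x"
    and \<eta>: "0 \<le> \<eta>" "\<eta> \<le> 1" "\<bar>\<eta>'\<bar> \<le> M" and s: "0 \<le> s"
  shows "(norm (v + s *\<^sub>R (\<eta>' *\<^sub>R half_sq_grad x + \<eta> *\<^sub>R half_sq_hess x v)))\<^sup>2
     \<le> (F x)\<^sup>2 * (1 + 2 * s * (\<eta>' * (grad x \<bullet> v / F x) + \<eta>) + s\<^sup>2 * (M + B)\<^sup>2)"
proof -
  define r where "r = F x"
  define Z where "Z = \<eta>' *\<^sub>R half_sq_grad x + \<eta> *\<^sub>R half_sq_hess x v"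
  have r: "0 < r" using F_bounds[OF x] by (auto simp: r_def)
  have nX: "norm (half_sq_grad x) = r" using norm_sgrad[OF x] r by (simp add: half_sq_grad_def r_def)
  have vZ: "v \<bullet> Z \<le> \<eta>' * r * (grad x \<bullet> v) + \<eta> * r\<^sup>2"
  proof -
    have "v \<bullet> half_sq_grad x = r * (grad x \<bullet> v)" using sgrad_inner[OF v(1)] by (simp add: half_sq_grad_def r_def inner_commute)
    moreover have "\<eta> * (half_sq_hess x v \<bullet> v) \<le> \<eta> * r\<^sup>2"
      using half_sq_hess_inner_le[OF x v(1)] v \<eta> by (intro mult_left_mono) (auto simp: r_def)
    ultimately show ?thesis by (simp add: Z_def inner_add_right inner_commute)
  qed
  have nZ: "norm Z \<le> (M + B) * r"
  proof -
    have "norm Z \<le> \<bar>\<eta>'\<bar> * norm (half_sq_grad x) + \<eta> * norm (half_sq_hess x v)"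
      unfolding Z_def using \<eta> by (metis abs_of_nonneg norm_scaleR norm_triangle_ineq)
    also have "\<dots> \<le> M * r + 1 * (B * r)"
      using \<eta> nX Db v B r by (intro add_mono mult_mono) (auto simp: r_def)
    finally show ?thesis by (simp add: algebra_simps)
  qed
  then have nZ2: "(norm Z)\<^sup>2 \<le> (M + B)\<^sup>2 * r\<^sup>2"
    by (metis norm_ge_zero power_mono power_mult_distrib)
  have "(norm (v + s *\<^sub>R Z))\<^sup>2 = (norm v)\<^sup>2 + 2 * s * (v \<bullet> Z) + s\<^sup>2 * (norm Z)\<^sup>2"
    by (simp add: power2_norm_eq_inner inner_add_left inner_add_right inner_commute)
      (simp add: power2_eq_square)
  also have "\<dots> \<le> r\<^sup>2 + 2 * s * (\<eta>' * r * (grad x \<bullet> v) + \<eta> * r\<^sup>2) + s\<^sup>2 * ((M + B)\<^sup>2 * r\<^sup>2)"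
    using vZ nZ2 s v by (intro add_mono mult_left_mono) (auto simp: r_def)
  also have "\<dots> = r\<^sup>2 * (1 + 2 * s * (\<eta>' * (grad x \<bullet> v / r) + \<eta>) + s\<^sup>2 * (M + B)\<^sup>2)"
    using r by (simp add: field_simps power2_eq_square)
  finally show ?thesis by (simp add: Z_def r_def)
qed

end

text \<open>The quotient of the expansions of speed and distance, multiplied out. The 2 in front of
  the constant is there because \<open>K5 * s\<^sup>2 \<le> 1 / 2\<close>: the product of the new
  error with the error of the divisor costs at most half of the constant, and the other half is
  exactly the sum of the remaining errors.\<close>

lemma second_order_quotient:
  fixes s b \<eta> K4 K5 L :: real
  assumes s: "0 \<le> s" "s \<le> 1" "2 * K5 * s\<^sup>2 \<le> 1" and K: "0 \<le> K4" "0 \<le> K5" "\<bar>b\<bar> \<le> L" and \<eta>: "0 \<le> \<eta>" "\<eta> \<le> 1"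
  shows "1 + s * (b + \<eta>) + s\<^sup>2 * K4 \<le>
    (1 + s * b + 2 * (K4 + L + K5 + L * K5) * s\<^sup>2) * (1 + s * \<eta> - s\<^sup>2 * K5)"
proof -
  define K where "K = 2 * (K4 + L + K5 + L * K5)"
  have L: "0 \<le> L" using K by linarith
  have K0: "0 \<le> K" using K L by (simp add: K_def)
  have 1: "K * (K5 * s\<^sup>2) \<le> K / 2" using s K0 mult_left_mono[of "K5 * s\<^sup>2" "1/2" K] by simp
  have 2: "0 \<le> K * s * \<eta>" using K0 s \<eta> by simp
  have 3: "- L \<le> b * \<eta>"
  proof -
    have "\<bar>b * \<eta>\<bar> \<le> L * 1" unfolding abs_mult using K \<eta> L by (intro mult_mono) auto
    then show ?thesis by linarith
  qed
  have 4: "s * b * K5 \<le> L * K5"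
  proof -
    have "\<bar>s * b\<bar> \<le> 1 * L" unfolding abs_mult using s K by (intro mult_mono) auto
    then show ?thesis using K by (intro mult_right_mono) auto
  qed
  have "K4 \<le> b * \<eta> + K + K * s * \<eta> - K5 - s * b * K5 - K * (K5 * s\<^sup>2)"
  proof -
    have "K / 2 = K4 + L + K5 + L * K5" by (simp add: K_def)
    then show ?thesis using 1 2 3 4 by linarith
  qed
  then have "s\<^sup>2 * K4 \<le> s\<^sup>2 * (b * \<eta> + K + K * s * \<eta> - K5 - s * b * K5 - K * (K5 * s\<^sup>2))"
    by (intro mult_left_mono) auto
  then show ?thesis unfolding K_def[symmetric]
    by (simp add: algebra_simps power2_eq_square)
qed

section \<open>A uniform bound for the condition length density of the competitor\<close>

context smooth_rho_chart
begin

text \<open>The first conclusion concerns positions and is applied at every parameter, including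
  those without a velocity; the second is applied almost everywhere. The lower bound
  \<open>m\<close> turns the absolute error in \<open>F (sgn y)\<close> into a relative one.
  \<open>K\<close> and \<open>s0\<close> do not depend on the point or on the velocity.\<close>

lemma pushed_integrand_bound:
  assumes sub: "cball x0 \<delta> \<subseteq> W" and B: "0 \<le> B" and \<delta>: "0 < \<delta>" and M: "0 \<le> M" and m: "0 < m"
    and gb: "\<And>x. x \<in> cball x0 \<delta> \<Longrightarrow> norm (grad x) \<le> B"
    and h: "\<And>x w. x \<in> cball x0 \<delta> \<Longrightarrow> norm (hess x w) \<le> B * norm w"
    and Db: "\<And>x w. x \<in> cball x0 \<delta> \<Longrightarrow> norm (half_sq_hess x w) \<le> B * norm w"
  obtains K s0 where "0 < s0" "s0 \<le> 1"
    "\<And>s x \<eta> y. \<lbrakk>0 \<le> s; s \<le> s0; x \<in> cball x0 (\<delta> / 2); norm x = 1; m \<le> F x; 0 \<le> \<eta>; \<eta> \<le> 1;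
       y = x + (s * \<eta>) *\<^sub>R half_sq_grad x\<rbrakk>
      \<Longrightarrow> 1 \<le> norm y \<and> sgn y \<in> cball x0 \<delta> \<and> 0 < F (sgn y)"
    "\<And>s x v \<eta> \<eta>' y y'. \<lbrakk>0 \<le> s; s \<le> s0; x \<in> cball x0 (\<delta> / 2); norm x = 1; m \<le> F x; 0 \<le> \<eta>; \<eta> \<le> 1;
       \<bar>\<eta>'\<bar> \<le> M; x \<bullet> v = 0; norm v = F x; y = x + (s * \<eta>) *\<^sub>R half_sq_grad x;
       y' = v + s *\<^sub>R (\<eta>' *\<^sub>R half_sq_grad x + \<eta> *\<^sub>R half_sq_hess x v)\<rbrakk>
      \<Longrightarrow> norm y' / F (sgn y) \<le> 1 + s * (\<eta>' * (grad x \<bullet> v / F x)) + K * s\<^sup>2"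
proof -
  \<comment> \<open>\<open>K4\<close> is half the quadratic term of the squared speed, halved by the
    square root; \<open>K5\<close> is the error of \<open>F (sgn y)\<close> relative to
    \<open>m\<close>; \<open>L\<close> bounds
    \<open>\<eta>' * (grad x \<bullet> v / F x)\<close>.\<close>
  define K4 where "K4 = (M + B)\<^sup>2 / 2"
  define K5 where "K5 = 416 * B / m"
  define L where "L = M * B"
  define K where "K = 2 * (K4 + L + K5 + L * K5)"
  have K45: "0 \<le> K4" "0 \<le> K5" "0 \<le> L" using B M m by (auto simp: K4_def K5_def L_def)
  \<comment> \<open>The bound \<open>\<delta> / 40\<close> keeps the projected points in the ball,
    the last one yields \<open>2 * K5 * s\<^sup>2 \<le> 1\<close>; the summand 1 in its denominator
    keeps \<open>s0\<close> positive if \<open>K5 = 0\<close>.\<close>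
  define s0 where "s0 = min (min 1 (\<delta> / 40)) (1 / (2 * K5 + 1))"
  have s0: "0 < s0" "s0 \<le> 1" "40 * s0 \<le> \<delta>" "s0 \<le> 1 / (2 * K5 + 1)"
  proof -
    show "0 < s0" using \<delta> K45 by (simp add: s0_def add_nonneg_pos)
    show "s0 \<le> 1" "s0 \<le> 1 / (2 * K5 + 1)" by (simp_all add: s0_def)
    have "s0 \<le> \<delta> / 40" by (simp add: s0_def)
    then show "40 * s0 \<le> \<delta>" by simp
  qed
  have sK: "2 * K5 * s\<^sup>2 \<le> 1" if "0 \<le> s" "s \<le> s0" for s
  proof -
    have "s\<^sup>2 \<le> s" using that s0 by (simp add: power2_eq_square mult_left_le)
    then have "(2 * K5) * s\<^sup>2 \<le> (2 * K5 + 1) * s" using K45 that by (intro mult_mono) auto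
    also have "\<dots> \<le> (2 * K5 + 1) * (1 / (2 * K5 + 1))" using K45 that s0 by (intro mult_left_mono) auto
    also have "\<dots> = 1" using K45 by simp
    finally show ?thesis .
  qed
  have low: "1 \<le> norm y \<and> sgn y \<in> cball x0 \<delta> \<and> 1 / 2 \<le> 1 + s * \<eta> - s\<^sup>2 * K5 \<and> F x * (1 + s * \<eta> - s\<^sup>2 * K5) \<le> F (sgn y)"
    if a: "0 \<le> s" "s \<le> s0" "x \<in> cball x0 (\<delta> / 2)" "norm x = 1" "m \<le> F x" "0 \<le> \<eta>" "\<eta> \<le> 1"
       "y = x + (s * \<eta>) *\<^sub>R half_sq_grad x" for s x \<eta> y
  proof -
    have xb: "x \<in> cball x0 \<delta>" using a \<delta> by auto
    have s\<eta>: "0 \<le> s * \<eta>" "s * \<eta> \<le> s" using a by (auto simp: mult_left_le)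
    then have e: "0 \<le> s * \<eta>" "s * \<eta> \<le> 1" "40 * (s * \<eta>) \<le> \<delta>" using a s0 by auto
    note P = pushed_point_bounds[OF sub B gb[OF xb] h a(3,4) e a(8)]
    have "416 * B * (s * \<eta>)\<^sup>2 \<le> 416 * B * s\<^sup>2" using s\<eta> B by (intro mult_left_mono power_mono) auto
    also have "\<dots> = m * (s\<^sup>2 * K5)" using m by (simp add: K5_def)
    also have "\<dots> \<le> F x * (s\<^sup>2 * K5)" using a K45 by (intro mult_right_mono) auto
    finally have "F x * (1 + s * \<eta> - s\<^sup>2 * K5) \<le> F (sgn y)" using P(3) by (simp add: algebra_simps)
    moreover have "1 / 2 \<le> 1 + s * \<eta> - s\<^sup>2 * K5" using sK[OF a(1,2)] s\<eta>(1) by (simp add: mult.commute)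
    ultimately show ?thesis using P by blast
  qed
  show ?thesis
  proof (rule that[of s0 K])
    show "0 < s0" "s0 \<le> 1" by fact+
  next
    fix s x \<eta> y
    assume a: "0 \<le> s" "s \<le> s0" "x \<in> cball x0 (\<delta> / 2)" "norm x = 1" "m \<le> F x" "0 \<le> \<eta>" "\<eta> \<le> 1"
       "y = x + (s * \<eta>) *\<^sub>R half_sq_grad x"
    have "0 < F x * (1 + s * \<eta> - s\<^sup>2 * K5)"
      using low[OF a] m a(5) by (intro mult_pos_pos) linarith+
    then show "1 \<le> norm y \<and> sgn y \<in> cball x0 \<delta> \<and> 0 < F (sgn y)" using low[OF a] by linarith
  next
    fix s x v \<eta> \<eta>' y y'
    assume a: "0 \<le> s" "s \<le> s0" "x \<in> cball x0 (\<delta> / 2)" "norm x = 1" "m \<le> F x" "0 \<le> \<eta>" "\<eta> \<le> 1"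
       and b: "\<bar>\<eta>'\<bar> \<le> M" "x \<bullet> v = 0" "norm v = F x" and y: "y = x + (s * \<eta>) *\<^sub>R half_sq_grad x"
       and y': "y' = v + s *\<^sub>R (\<eta>' *\<^sub>R half_sq_grad x + \<eta> *\<^sub>R half_sq_hess x v)"
    define c where "c = \<eta>' * (grad x \<bullet> v / F x)"
    have xb: "x \<in> cball x0 \<delta>" using a \<delta> by auto
    then have xW: "x \<in> W" using sub by auto
    have r: "0 < F x" using m a by linarith
    have cL: "\<bar>c\<bar> \<le> L"
    proof -
      have "\<bar>grad x \<bullet> v\<bar> \<le> B * F x"
        using order_trans[OF Cauchy_Schwarz_ineq2[of "grad x" v] mult_right_mono[OF gb[OF xb] norm_ge_zero]]
        by (simp add: b)
      then have "\<bar>grad x \<bullet> v / F x\<bar> \<le> B" using r by (simp add: divide_simps)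
      then show ?thesis unfolding c_def L_def abs_mult using b M by (intro mult_mono) auto
    qed
    define q where "q = 1 + s * (c + \<eta>) + s\<^sup>2 * K4"
    have Q: "q \<le> (1 + s * c + K * s\<^sup>2) * (1 + s * \<eta> - s\<^sup>2 * K5)"
      unfolding q_def K_def
      by (rule second_order_quotient[OF a(1) order_trans[OF a(2) s0(2)] sK[OF a(1,2)] K45(1,2) cL a(6,7)])
    have V: "(norm y')\<^sup>2 \<le> (F x)\<^sup>2 * (1 + 2 * s * (c + \<eta>) + s\<^sup>2 * (M + B)\<^sup>2)"
      unfolding y' c_def by (rule pushed_velocity_bound[OF B M Db[OF xb] xW a(4) b(2,3) a(6,7) b(1) a(1)])
    have eq: "1 + 2 * s * (c + \<eta>) + s\<^sup>2 * (M + B)\<^sup>2 = 2 * q - 1"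
      by (simp add: q_def K4_def algebra_simps)
    have "0 \<le> (F x)\<^sup>2 * (2 * q - 1)" using V eq by (metis order_trans zero_le_power2)
    then have q0: "0 \<le> q" using r by (simp add: zero_le_mult_iff)
    \<comment> \<open>This replaces a square root: with \<open>q = 1 + a\<close> it is
      \<open>1 + 2 * a \<le> (1 + a)\<^sup>2\<close>.\<close>
    have "2 * q - 1 \<le> q\<^sup>2" using zero_le_power2[of "q - 1"] by (simp add: power2_eq_square algebra_simps)
    then have "(F x)\<^sup>2 * (2 * q - 1) \<le> (F x * q)\<^sup>2" by (simp add: power_mult_distrib mult_left_mono)
    then have le2: "(norm y')\<^sup>2 \<le> (F x * q)\<^sup>2" using V unfolding eq by (rule order_trans[rotated])
    have "0 \<le> F x * q" using r q0 by (intro mult_nonneg_nonneg) linarith+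
    with le2 have ny': "norm y' \<le> F x * q" by (rule power2_le_imp_le)
    note low' = low[OF a y]
    define w where "w = 1 + s * \<eta> - s\<^sup>2 * K5"
    have w: "1 / 2 \<le> w" "F x * w \<le> F (sgn y)" using low' by (auto simp: w_def)
    have "norm y' / F (sgn y) \<le> (F x * q) / (F x * w)"
      using ny' w r q0 by (intro frac_le) auto
    also have "\<dots> = q / w" using r by simp
    also have "\<dots> \<le> 1 + s * c + K * s\<^sup>2" using Q w by (simp add: w_def[symmetric] pos_divide_le_eq)
    finally show "norm y' / F (sgn y) \<le> 1 + s * (\<eta>' * (grad x \<bullet> v / F x)) + K * s\<^sup>2"
      by (simp add: c_def)
  qed
qed

end

section \<open>Lipschitz curves\<close>

lemma lipschitz_on_clamp:
  fixes f :: "real \<Rightarrow> 'b::metric_space"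
  assumes "C-lipschitz_on {a..b} f" "a \<le> b"
  shows "C-lipschitz_on UNIV (\<lambda>t. f (max a (min b t)))"
proof (rule lipschitz_onI)
  fix x y :: real
  have "dist (f (max a (min b x))) (f (max a (min b y))) \<le> C * dist (max a (min b x)) (max a (min b y))"
    using assms by (intro lipschitz_onD[OF assms(1)]) auto
  also have "\<dots> \<le> C * dist x y"
    using lipschitz_on_nonneg[OF assms(1)] by (intro mult_left_mono) (auto simp: dist_real_def max_def min_def)
  finally show "dist (f (max a (min b x))) (f (max a (min b y))) \<le> C * dist x y" .
qed (rule lipschitz_on_nonneg[OF assms(1)])

lemma lipschitz_interval_FTC:
  fixes f :: "real \<Rightarrow> real"
  assumes lip: "C-lipschitz_on {a..b} f" and ab: "a < b"
  obtains g Z where "g \<in> borel_measurable borel" "negligible Z"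
    "\<And>t. t \<in> {a..b} - Z \<Longrightarrow> (f has_real_derivative g t) (at t)"
    "\<And>s t. a \<le> s \<Longrightarrow> s \<le> t \<Longrightarrow> t \<le> b \<Longrightarrow> (g has_integral (f t - f s)) {s..t}"
proof -
  obtain g Z where gZ: "g \<in> borel_measurable borel" "negligible Z"
    "\<And>x. x \<notin> Z \<Longrightarrow> ((\<lambda>t. f (max a (min b t))) has_real_derivative g x) (at x)"
    "\<And>s t. s \<le> t \<Longrightarrow> (g has_integral (f (max a (min b t)) - f (max a (min b s)))) {s..t}"
    using lipschitz_FTC[OF lipschitz_on_clamp[OF lip less_imp_le[OF ab]]] by metis
  show ?thesis
  \<comment> \<open>At \<open>a\<close> and \<open>b\<close> the clamped function need not have the
    derivative of \<open>f\<close>, so the end points join the null set.\<close>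
  proof (rule that[of g "Z \<union> {a,b}"])
    show "(f has_real_derivative g t) (at t)" if "t \<in> {a..b} - (Z \<union> {a,b})" for t
      using gZ(3)[of t] that
      by (rule_tac DERIV_cong_ev[OF refl _ refl, THEN iffD1])
        (auto intro!: eventually_nhds_in_open[of "{a<..<b}", THEN eventually_mono])
    show "(g has_integral (f t - f s)) {s..t}" if "a \<le> s" "s \<le> t" "t \<le> b" for s t
      using gZ(4)[of s t] that by simp
  qed (use gZ in auto)
qed

text \<open>Coordinatewise differentiation. The Borel function \<open>G\<close> stands in for
  \<open>vector_derivative\<close>, whose values are unspecified where \<open>f\<close> is not
  differentiable, and so makes the speed measurable.\<close>

lemma lipschitz_interval_vector_derivative:
  fixes f :: "real \<Rightarrow> 'b::euclidean_space"
  assumes lip: "C-lipschitz_on {a..b} f" and ab: "a < b"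
  obtains G Z where "G \<in> borel_measurable borel" "negligible Z"
    "\<And>t. t \<in> {a..b} - Z \<Longrightarrow> (f has_vector_derivative G t) (at t)"
proof -
  have "\<exists>g Z. g \<in> borel_measurable borel \<and> negligible Z \<and>
      (\<forall>t\<in>{a..b} - Z. ((\<lambda>t. f t \<bullet> i) has_real_derivative g t) (at t))" if "i \<in> Basis" for i
  proof -
    have "C-lipschitz_on {a..b} (\<lambda>t. f t \<bullet> i)"
    proof (rule lipschitz_onI)
      fix x y assume "x \<in> {a..b}" "y \<in> {a..b}"
      then have "dist (f x) (f y) \<le> C * dist x y" by (rule lipschitz_onD[OF lip])
      moreover have "dist (f x \<bullet> i) (f y \<bullet> i) \<le> dist (f x) (f y)"
        using Basis_le_norm[OF that, of "f x - f y"] by (simp add: dist_norm inner_diff_left)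
      ultimately show "dist (f x \<bullet> i) (f y \<bullet> i) \<le> C * dist x y" by linarith
    qed (rule lipschitz_on_nonneg[OF lip])
    from lipschitz_interval_FTC[OF this ab] show ?thesis by metis
  qed
  then obtain g Z where gZ: "\<And>i. i \<in> Basis \<Longrightarrow> g i \<in> borel_measurable borel" "\<And>i. i \<in> Basis \<Longrightarrow> negligible (Z i)"
    "\<And>i t. i \<in> Basis \<Longrightarrow> t \<in> {a..b} - Z i \<Longrightarrow> ((\<lambda>t. f t \<bullet> i) has_real_derivative g i t) (at t)"
    by metis
  show ?thesis
  proof (rule that[of "\<lambda>t. \<Sum>i\<in>Basis. g i t *\<^sub>R i" "\<Union>i\<in>Basis. Z i"])
    show "(\<lambda>t. \<Sum>i\<in>Basis. g i t *\<^sub>R i) \<in> borel_measurable borel"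
      using gZ(1) by (intro borel_measurable_sum borel_measurable_scaleR) auto
    show "negligible (\<Union>i\<in>Basis. Z i)" using gZ(2) by (intro negligible_Union) auto
    show "(f has_vector_derivative (\<Sum>i\<in>Basis. g i t *\<^sub>R i)) (at t)" if "t \<in> {a..b} - (\<Union>i\<in>Basis. Z i)" for t
    proof -
      have "((\<lambda>t. \<Sum>i\<in>Basis. (f t \<bullet> i) *\<^sub>R i) has_vector_derivative (\<Sum>i\<in>Basis. g i t *\<^sub>R i)) (at t)"
      proof (rule has_vector_derivative_sum)
        fix i :: 'b assume i: "i \<in> Basis"
        have "((\<lambda>t. f t \<bullet> i) has_real_derivative g i t) (at t)" using gZ(3)[OF i] that i by blast
        from has_vector_derivative_scaleR[OF this has_vector_derivative_const[of i]]
        show "((\<lambda>t. (f t \<bullet> i) *\<^sub>R i) has_vector_derivative g i t *\<^sub>R i) (at t)" by simp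
      qed
      then show ?thesis by (simp add: euclidean_representation)
    qed
  qed
qed

lemma AE_lebesgue_not_negligible: "negligible Z \<Longrightarrow> AE t in lebesgue. t \<notin> Z"
  by (simp add: negligible_iff_null_sets AE_not_in)

lemma arclength_unit_speed:
  fixes \<gamma> :: "real \<Rightarrow> 'a::euclidean_space"
  assumes lip: "C-lipschitz_on {a..b} \<gamma>" and ab: "a < b"
    and len: "\<And>s t. a \<le> s \<Longrightarrow> s \<le> t \<Longrightarrow> t \<le> b \<Longrightarrow> condition_length N s t \<gamma> = ennreal (t - s)"
    and cont: "continuous_on {a..b} (\<lambda>t. rho N (\<gamma> t))"
    and pos: "\<And>t. t \<in> {a..b} \<Longrightarrow> 0 < rho N (\<gamma> t)"
  obtains Z where "negligible Z"
    "\<And>t. t \<in> {a..b} - Z \<Longrightarrow> norm (vector_derivative \<gamma> (at t)) = rho N (\<gamma> t)"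
proof -
  obtain G Z where G: "G \<in> borel_measurable borel" "negligible Z"
    "\<And>t. t \<in> {a..b} - Z \<Longrightarrow> (\<gamma> has_vector_derivative G t) (at t)"
    using lipschitz_interval_vector_derivative[OF lip ab] by metis
  \<comment> \<open>Clamping the parameter makes \<open>R\<close> continuous and positive on the
    whole line.\<close>
  define R where "R t = rho N (\<gamma> (max a (min b t)))" for t
  have "continuous_on UNIV R"
    unfolding R_def using ab
    by (intro continuous_on_compose2[OF cont] continuous_intros) auto
  then have Rm: "R \<in> borel_measurable borel" by (rule borel_measurable_continuous_onI)
  have Rp: "0 < R t" for t unfolding R_def using ab by (intro pos) auto
  define h where "h t = norm (G t) / R t" for t
  have h0: "0 \<le> h t" for t using Rp[of t] by (simp add: h_def)
  have hm: "h \<in> borel_measurable borel" unfolding h_def using G Rm by measurable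
  have hI: "(h has_integral (t - s)) {s..t}" if st: "a \<le> s" "s \<le> t" "t \<le> b" for s t
  proof -
    let ?f = "\<lambda>u. if u \<in> {s..t} then h u else 0"
    have "(\<integral>\<^sup>+u. ennreal (?f u) \<partial>lebesgue) = condition_length N s t \<gamma>"
      unfolding condition_length_def
    proof (rule nn_integral_cong_AE)
      show "AE u in lebesgue. ennreal (?f u) = ennreal (norm (vector_derivative \<gamma> (at u))) * inverse (ennreal (rho N (\<gamma> u))) * indicator {s..t} u"
        using AE_lebesgue_not_negligible[OF G(2)]
      proof eventually_elim
        case (elim u)
        show ?case
        proof (cases "u \<in> {s..t}")
          case True
          then have "vector_derivative \<gamma> (at u) = G u" "R u = rho N (\<gamma> u)"
            using elim st G(3)[of u, THEN vector_derivative_at] by (auto simp: R_def)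
          then show ?thesis using True Rp[of u]
            by (simp add: h_def divide_inverse ennreal_mult inverse_ennreal)
        qed auto
      qed
    qed
    then have "(\<integral>\<^sup>+u. ennreal (?f u) \<partial>lebesgue) = ennreal (t - s)" using len[OF st] by simp
    moreover have "?f \<in> lebesgue \<rightarrow>\<^sub>M borel"
    proof -
      have "?f \<in> borel_measurable borel" using hm by measurable
      then show ?thesis by (simp add: measurable_completion)
    qed
    ultimately have "(?f has_integral (t - s)) UNIV"
      using has_integral_iff_nn_integral_lebesgue[of ?f "t - s"] h0 st by simp
    then show ?thesis by (simp only: has_integral_restrict_UNIV)
  qed
  \<comment> \<open>All integrals of \<open>k\<close> over intervals vanish, hence \<open>k = 0\<close> almost everywhere by Lebesgue differentiation.\<close>
  define k where "k u = (if u \<in> {a..b} then h u - 1 else 0)" for u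
  have kI: "(k has_integral (0 - 0)) {s..t}" if "s \<le> t" for s t :: real
  proof -
    have "((\<lambda>u. h u - 1) has_integral 0) ({a..b} \<inter> {s..t})"
    proof (cases "max a s \<le> min b t")
      case True
      have "((\<lambda>u. h u - 1) has_integral ((min b t - max a s) - (min b t - max a s))) {max a s..min b t}"
        using hI[of "max a s" "min b t"] True has_integral_const_real[of "1::real" "max a s" "min b t"]
        by (intro has_integral_diff) auto
      then show ?thesis by (simp add: Int_atLeastAtMost)
    next
      case False
      then show ?thesis by (simp add: Int_atLeastAtMost)
    qed
    then show ?thesis unfolding k_def[abs_def] has_integral_restrict_Int by simp
  qed
  obtain Z2 where Z2: "negligible Z2" "\<And>x. x \<notin> Z2 \<Longrightarrow> ((\<lambda>_. 0) has_real_derivative k x) (at_right x)"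
    using right_difference_quotient_AE[of k "\<lambda>_. 0", OF kI] by metis
  show ?thesis
  proof (rule that[of "Z \<union> Z2"])
    fix t assume t: "t \<in> {a..b} - (Z \<union> Z2)"
    have "k t = 0"
    proof -
      have "((\<lambda>_. 0) \<longlongrightarrow> k t) (at_right t)"
        using Z2(2)[of t] t by (simp add: has_field_derivative_iff)
      then show ?thesis by (simp add: tendsto_const_iff)
    qed
    then have "h t = 1" using t by (simp add: k_def)
    moreover have "vector_derivative \<gamma> (at t) = G t" "R t = rho N (\<gamma> t)"
      using t G(3)[of t, THEN vector_derivative_at] by (auto simp: R_def)
    ultimately show "norm (vector_derivative \<gamma> (at t)) = rho N (\<gamma> t)"
      using Rp[of t] by (simp add: h_def)
  qed (use G Z2 in auto)
qed

text \<open>Radial projection removes the radial part of the velocity and divides by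
  \<open>norm (y t)\<close>; outside the open unit ball neither operation increases the norm, so
  returning to the sphere costs nothing in the length estimate.\<close>

lemma sgn_derivative_norm_le:
  fixes y :: "real \<Rightarrow> 'a::euclidean_space"
  assumes y: "(y has_vector_derivative y') (at t)" and n: "1 \<le> norm (y t)"
  obtains c' where "((\<lambda>t. sgn (y t)) has_vector_derivative c') (at t)" "norm c' \<le> norm y'"
proof -
  have y0: "y t \<noteq> 0" using n by auto
  define e where "e = sgn (y t)"
  have ee: "e \<bullet> e = 1" using y0 by (simp add: e_def norm_eq_1[symmetric] norm_sgn)
  have dn: "((\<lambda>t. norm (y t)) has_real_derivative (y' \<bullet> e)) (at t)"
  proof -
    have "((\<lambda>t. norm (y t)) has_derivative (\<lambda>h. (h *\<^sub>R y') \<bullet> e)) (at t)"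
      unfolding e_def
      by (rule has_derivative_compose[OF y[unfolded has_vector_derivative_def] has_derivative_norm[OF y0]])
    then show ?thesis by (simp add: has_field_derivative_def mult_commute_abs)
  qed
  define c' where "c' = inverse (norm (y t)) *\<^sub>R (y' - (y' \<bullet> e) *\<^sub>R e)"
  have "((\<lambda>t. inverse (norm (y t)) *\<^sub>R y t) has_vector_derivative
      (inverse (norm (y t)) *\<^sub>R y' + (- (inverse (norm (y t)) * (y' \<bullet> e) * inverse (norm (y t)))) *\<^sub>R y t)) (at t)"
  proof (rule has_vector_derivative_scaleR[OF _ y])
    show "((\<lambda>t. inverse (norm (y t))) has_real_derivative
        - (inverse (norm (y t)) * (y' \<bullet> e) * inverse (norm (y t)))) (at t)"
      using y0 by (auto intro!: derivative_eq_intros dn)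
  qed
  moreover have "inverse (norm (y t)) *\<^sub>R y' + (- (inverse (norm (y t)) * (y' \<bullet> e) * inverse (norm (y t)))) *\<^sub>R y t = c'"
    by (simp add: c'_def e_def sgn_div_norm algebra_simps)
  ultimately have "((\<lambda>t. sgn (y t)) has_vector_derivative c') (at t)"
    by (simp add: sgn_div_norm[abs_def])
  moreover have "norm c' \<le> norm y'"
  proof -
    have "(norm (y' - (y' \<bullet> e) *\<^sub>R e))\<^sup>2 = (norm y')\<^sup>2 - (y' \<bullet> e)\<^sup>2"
      using ee by (simp add: power2_norm_eq_inner inner_diff_left inner_diff_right inner_commute)
        (simp add: power2_eq_square)
    then have "(norm (y' - (y' \<bullet> e) *\<^sub>R e))\<^sup>2 \<le> (norm y')\<^sup>2" by simp
    then have le: "norm (y' - (y' \<bullet> e) *\<^sub>R e) \<le> norm y'" by (rule power2_le_imp_le) simp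
    have "inverse (norm (y t)) \<le> 1" using inverse_le_1_iff[of "norm (y t)"] n by simp
    then have "norm c' \<le> 1 * norm (y' - (y' \<bullet> e) *\<^sub>R e)"
      unfolding c'_def norm_scaleR by (intro mult_right_mono) auto
    then show ?thesis using le by simp
  qed
  ultimately show ?thesis by (rule that)
qed

text \<open>The constant 2 is not sharp; the estimate only serves to make the competitor
  Lipschitz.\<close>

lemma dist_sgn_le:
  fixes a b :: "'a::real_inner"
  assumes "1 \<le> norm a" "1 \<le> norm b"
  shows "dist (sgn a) (sgn b) \<le> 2 * dist a b"
proof -
  have a0: "norm a \<noteq> 0" and b0: "norm b \<noteq> 0" using assms by linarith+
  have "norm a *\<^sub>R (sgn a - sgn b) = (a - b) + (norm b - norm a) *\<^sub>R sgn b"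
    using a0 b0 by (simp add: sgn_div_norm algebra_simps)
  then have "norm (norm a *\<^sub>R (sgn a - sgn b)) \<le> norm (a - b) + \<bar>norm b - norm a\<bar> * norm (sgn b)"
    by (metis norm_scaleR norm_triangle_ineq real_norm_def)
  also have "norm (sgn b) = 1" using b0 by (simp add: norm_sgn)
  also have "norm (a - b) + \<bar>norm b - norm a\<bar> * 1 \<le> 2 * norm (a - b)"
    using norm_triangle_ineq3[of b a] by (simp add: norm_minus_commute)
  finally have "norm a * norm (sgn a - sgn b) \<le> 2 * norm (a - b)" by simp
  moreover have "1 * norm (sgn a - sgn b) \<le> norm a * norm (sgn a - sgn b)"
    using assms by (intro mult_right_mono) auto
  ultimately show ?thesis by (simp add: dist_norm)
qed

text \<open>The admissible \<open>e\<close> may shrink as \<open>t\<close> varies, so a maximum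
  principle for the difference to a chord takes the place of dyadic subdivision. Continuity takes
  care of the end points of \<open>I\<close>, where no midpoint inequality is available.\<close>

lemma locally_midpoint_convex_imp_convex:
  fixes f :: "real \<Rightarrow> real"
  assumes I: "is_interval I" and cont: "continuous_on I f"
    and mid: "\<And>t. t \<in> interior I \<Longrightarrow> \<exists>e>0. \<forall>d. 0 < d \<and> d < e \<longrightarrow> 2 * f t \<le> f (t - d) + f (t + d)"
  shows "convex_on I f"
proof (rule convex_on_linorderI)
  show "convex I" using I by (rule is_interval_convex)
next
  fix t x y :: real
  assume t: "0 < t" "t < 1" and xy: "x \<in> I" "y \<in> I" "x < y"
  define z where "z = (1 - t) *\<^sub>R x + t *\<^sub>R y"
  define k where "k = (f y - f x) / (y - x)"
  define \<phi> where "\<phi> s = f s - (f x + k * (s - x))" for s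
  have sub: "{x..y} \<subseteq> I" using I xy unfolding is_interval_1 by (meson atLeastAtMost_iff subsetI)
  have ends: "\<phi> x = 0" "\<phi> y = 0" using xy by (auto simp: \<phi>_def k_def)
  have zin: "z \<in> {x..y}"
  proof -
    have "z = x + t * (y - x)" by (simp add: z_def algebra_simps)
    moreover have "0 \<le> t * (y - x)" "t * (y - x) \<le> 1 * (y - x)"
      using t xy by (auto intro: mult_right_mono)
    ultimately show ?thesis by simp
  qed
  have c\<phi>: "continuous_on {x..y} \<phi>"
    unfolding \<phi>_def using continuous_on_subset[OF cont sub] by (intro continuous_intros)
  have "\<phi> z \<le> 0"
  proof (rule ccontr)
    assume "\<not> \<phi> z \<le> 0"
    obtain w where w: "w \<in> {x..y}" "\<And>s. s \<in> {x..y} \<Longrightarrow> \<phi> s \<le> \<phi> w"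
      using continuous_attains_sup[OF _ _ c\<phi>] zin by (metis compact_Icc empty_iff)
    have Mpos: "0 < \<phi> w" using w(2)[OF zin] \<open>\<not> \<phi> z \<le> 0\<close> by linarith
    \<comment> \<open>The midpoint inequality fails at the leftmost maximum of \<open>\<phi>\<close>.\<close>
    define A where "A = {s \<in> {x..y}. \<phi> s = \<phi> w}"
    have "closed A" unfolding A_def
      by (rule continuous_closed_preimage_constant[OF c\<phi> closed_atLeastAtMost])
    moreover have "A = {x..y} \<inter> A" by (auto simp: A_def)
    ultimately have "compact A" by (metis compact_Icc compact_Int_closed)
    moreover have "A \<noteq> {}" using w by (auto simp: A_def)
    ultimately obtain t0 where t0: "t0 \<in> A" "\<And>s. s \<in> A \<Longrightarrow> t0 \<le> s"
      using compact_attains_inf by metis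
    have t0xy: "x < t0" "t0 < y" "\<phi> t0 = \<phi> w"
      using t0(1) ends Mpos by (auto simp: A_def less_le)
    have "t0 \<in> interior I"
      using t0xy sub by (intro interiorI[of "{x<..<y}"]) auto
    then obtain e where e: "0 < e" "\<And>d. 0 < d \<and> d < e \<Longrightarrow> 2 * f t0 \<le> f (t0 - d) + f (t0 + d)"
      using mid by blast
    define d where "d = min (e / 2) (min (t0 - x) (y - t0))"
    have d: "0 < d" "d < e" "d \<le> t0 - x" "d \<le> y - t0" using e t0xy by (auto simp: d_def)
    have "2 * \<phi> t0 \<le> \<phi> (t0 - d) + \<phi> (t0 + d)"
      using e(2)[of d] d by (simp add: \<phi>_def algebra_simps)
    moreover have "\<phi> (t0 - d) < \<phi> w"
      using w(2)[of "t0 - d"] t0(2)[of "t0 - d"] d t0xy by (force simp: A_def)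
    moreover have "\<phi> (t0 + d) \<le> \<phi> w" using d t0xy by (intro w(2)) auto
    ultimately show False using t0xy by linarith
  qed
  moreover have "k * (z - x) = t * (f y - f x)"
  proof -
    have "z - x = t * (y - x)" by (simp add: z_def algebra_simps)
    then show ?thesis using xy by (simp add: k_def)
  qed
  ultimately show "f ((1 - t) *\<^sub>R x + t *\<^sub>R y) \<le> (1 - t) * f x + t * f y"
    unfolding z_def[symmetric] by (simp add: \<phi>_def algebra_simps)
qed

section \<open>The variation of the condition length\<close>

lemma abs_ln_diff_le:
  fixes m x y :: real
  assumes "0 < m" "m \<le> x" "m \<le> y"
  shows "\<bar>ln x - ln y\<bar> \<le> \<bar>x - y\<bar> / m"
proof -
  have *: "ln x - ln y \<le> \<bar>x - y\<bar> / m" if "m \<le> x" "m \<le> y" for x y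
  proof -
    have "ln x - ln y \<le> (x - y) / y" using that assms(1) by (intro ln_diff_le) auto
    also have "\<dots> \<le> \<bar>x - y\<bar> / m" using that assms(1) by (intro frac_le) auto
    finally show ?thesis .
  qed
  show ?thesis using *[of x y] *[of y x] assms by (simp add: abs_le_iff abs_minus_commute)
qed

context smooth_rho_chart
begin

text \<open>Minimality is known for the whole of \<open>{a..b}\<close>, while the chart only covers
  the part near \<open>t0\<close>. The competitor therefore runs over \<open>{a..b}\<close> and
  agrees with \<open>\<gamma>\<close> outside the support of the tent.\<close>

lemma midpoint_inequality:
  fixes \<gamma> :: "real \<Rightarrow> 'a"
  assumes sub: "cball x0 \<delta> \<subseteq> W" and B: "0 \<le> B" and \<delta>: "0 < \<delta>"
    and gb: "\<And>x. x \<in> cball x0 \<delta> \<Longrightarrow> norm (grad x) \<le> B"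
    and hb: "\<And>x w. x \<in> cball x0 \<delta> \<Longrightarrow> norm (hess x w) \<le> B * norm w"
    and Db: "\<And>x w. x \<in> cball x0 \<delta> \<Longrightarrow> norm (half_sq_hess x w) \<le> B * norm w"
    and min: "condition_minimizing_geodesic N a b \<gamma>"
    and Z: "negligible Z" "\<And>t. t \<in> {a..b} - Z \<Longrightarrow> norm (vector_derivative \<gamma> (at t)) = rho N (\<gamma> t)"
    and pos: "\<And>t. t \<in> {a..b} \<Longrightarrow> 0 < rho N (\<gamma> t)"
    and d: "0 < d" "a \<le> t0 - d" "t0 + d \<le> b"
    and ball: "\<And>t. t \<in> {t0 - d..t0 + d} \<Longrightarrow> \<gamma> t \<in> cball x0 (\<delta> / 2)"
  shows "ln (rho N (\<gamma> (t0 - d))) + ln (rho N (\<gamma> (t0 + d))) \<le> 2 * ln (rho N (\<gamma> t0))"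
proof -
  define p q where "p = t0 - d" and "q = t0 + d"
  have pq: "a \<le> p" "p < t0" "t0 < q" "q \<le> b" "p < q" "a < b" using d by (auto simp: p_def q_def)
  obtain C where C: "C-lipschitz_on {a..b} \<gamma>" and im: "\<gamma> ` {a..b} \<subseteq> sphere 0 1 - N"
    using min by (auto simp: condition_minimizing_geodesic_def lipschitz_curve_def)
  have n1: "norm (\<gamma> t) = 1" if "t \<in> {a..b}" for t using im that by (metis DiffD1 image_subset_iff mem_sphere_0)
  have ball': "\<gamma> t \<in> cball x0 (\<delta> / 2)" "\<gamma> t \<in> cball x0 \<delta>" "\<gamma> t \<in> W" if "t \<in> {p..q}" for t
  proof -
    show 1: "\<gamma> t \<in> cball x0 (\<delta> / 2)" using that by (intro ball) (auto simp: p_def q_def)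
    then show 2: "\<gamma> t \<in> cball x0 \<delta>" using \<delta> by auto
    then show "\<gamma> t \<in> W" using sub by auto
  qed
  have n1': "norm (\<gamma> t) = 1" if "t \<in> {p..q}" for t using that pq by (intro n1) auto
  have F\<gamma>: "F (\<gamma> t) = rho N (\<gamma> t)" if "t \<in> {p..q}" for t using F_rho[OF ball'(3)[OF that] n1'[OF that]] .
  have Cpq: "C-lipschitz_on {p..q} \<gamma>" using C by (rule lipschitz_on_subset) (use pq in auto)
  have C0: "0 \<le> C" using C by (rule lipschitz_on_nonneg)
  have FL: "\<bar>F x - F y\<bar> \<le> B * norm (x - y)" if "x \<in> cball x0 \<delta>" "y \<in> cball x0 \<delta>" for x y
  proof -
    have "norm (F x - F y) \<le> B * norm (x - y)"
    proof (rule differentiable_bound[OF convex_cball _ _ that])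
      fix u assume u: "u \<in> cball x0 \<delta>"
      show "(F has_derivative (\<lambda>w. grad u \<bullet> w)) (at u within cball x0 \<delta>)"
        using F_derivative u sub by (blast intro: has_derivative_at_withinI)
      show "onorm (\<lambda>w. grad u \<bullet> w) \<le> B"
      proof (rule onorm_le)
        fix w show "norm (grad u \<bullet> w) \<le> B * norm w"
          using order_trans[OF Cauchy_Schwarz_ineq2 mult_right_mono[OF gb[OF u] norm_ge_zero]] by simp
      qed
    qed
    then show ?thesis by simp
  qed
  have XL: "norm (half_sq_grad x - half_sq_grad y) \<le> B * norm (x - y)" if "x \<in> cball x0 \<delta>" "y \<in> cball x0 \<delta>" for x y
  proof (rule differentiable_bound[OF convex_cball _ _ that])
    fix u assume u: "u \<in> cball x0 \<delta>"
    show "(half_sq_grad has_derivative half_sq_hess u) (at u within cball x0 \<delta>)"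
      using half_sq_grad_derivative u sub by (blast intro: has_derivative_at_withinI)
    show "onorm (half_sq_hess u) \<le> B" by (rule onorm_le) (rule Db[OF u])
  qed
  have FcL: "\<bar>F (\<gamma> s) - F (\<gamma> t)\<bar> \<le> B * C * dist s t" if "s \<in> {p..q}" "t \<in> {p..q}" for s t
  proof -
    have "\<bar>F (\<gamma> s) - F (\<gamma> t)\<bar> \<le> B * dist (\<gamma> s) (\<gamma> t)"
      using FL[OF ball'(2)[OF that(1)] ball'(2)[OF that(2)]] by (simp add: dist_norm)
    also have "\<dots> \<le> B * (C * dist s t)" using lipschitz_onD[OF Cpq that] B by (rule mult_left_mono)
    finally show ?thesis by simp
  qed
  have "(B * C)-lipschitz_on {p..q} (\<lambda>t. F (\<gamma> t))"
    using FcL B C0 by (intro lipschitz_onI) (auto simp: dist_real_def)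
  then have cF: "continuous_on {p..q} (\<lambda>t. F (\<gamma> t))" by (rule lipschitz_on_continuous_on)
  \<comment> \<open>The minimum over the compact arc provides the positive \<open>m\<close> on which
    the uniform error constant depends.\<close>
  obtain tm where tm: "tm \<in> {p..q}" "\<And>t. t \<in> {p..q} \<Longrightarrow> F (\<gamma> tm) \<le> F (\<gamma> t)"
    using continuous_attains_inf[OF compact_Icc _ cF] pq by auto
  define m where "m = F (\<gamma> tm)"
  have m: "0 < m" "\<And>t. t \<in> {p..q} \<Longrightarrow> m \<le> F (\<gamma> t)"
    using tm F_bounds(1)[OF ball'(3)[OF tm(1)] n1'[OF tm(1)]] by (auto simp: m_def)
  define M where "M = 1 / d"
  have M: "0 \<le> M" using d by (simp add: M_def)
  define u where "u t = ln (F (\<gamma> t))" for t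
  have uL: "(B * C / m)-lipschitz_on {p..q} u"
  proof (rule lipschitz_onI)
    fix s t assume st: "s \<in> {p..q}" "t \<in> {p..q}"
    have "dist (u s) (u t) \<le> \<bar>F (\<gamma> s) - F (\<gamma> t)\<bar> / m"
      unfolding u_def dist_real_def using m st by (intro abs_ln_diff_le) auto
    also have "\<dots> \<le> B * C * dist s t / m" using FcL[OF st] m by (intro divide_right_mono) auto
    finally show "dist (u s) (u t) \<le> B * C / m * dist s t" by simp
  qed (use B C0 m in auto)
  obtain g Z1 where g: "negligible Z1"
    "\<And>t. t \<in> {p..q} - Z1 \<Longrightarrow> (u has_real_derivative g t) (at t)"
    "\<And>s t. p \<le> s \<Longrightarrow> s \<le> t \<Longrightarrow> t \<le> q \<Longrightarrow> (g has_integral (u t - u s)) {s..t}"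
    using lipschitz_interval_FTC[OF uL pq(5)] by metis
  obtain G Z2 where G: "negligible Z2"
    "\<And>t. t \<in> {a..b} - Z2 \<Longrightarrow> (\<gamma> has_vector_derivative G t) (at t)"
    using lipschitz_interval_vector_derivative[OF C pq(6)] by metis
  define \<eta> where "\<eta> t = 1 - \<bar>t - t0\<bar> / d" for t
  \<comment> \<open>The value at the kink \<open>t0\<close> is a convention; \<open>t0\<close> will
    belong to the null set \<open>Bad\<close>.\<close>
  define \<eta>' where "\<eta>' t = (if t < t0 then 1 / d else - 1 / d)" for t
  have \<eta>01: "0 \<le> \<eta> t" "\<eta> t \<le> 1" if "t \<in> {p..q}" for t
    using that d by (auto simp: \<eta>_def p_def q_def divide_simps abs_le_iff)
  have \<eta>L: "\<bar>\<eta> s - \<eta> t\<bar> \<le> M * dist s t" for s t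
  proof -
    have "\<bar>\<eta> s - \<eta> t\<bar> = \<bar>\<bar>t - t0\<bar> - \<bar>s - t0\<bar>\<bar> / d"
      using d by (simp add: \<eta>_def diff_divide_distrib[symmetric])
    also have "\<dots> \<le> dist s t / d" using d by (intro divide_right_mono) (auto simp: dist_real_def)
    finally show ?thesis by (simp add: M_def)
  qed
  have \<eta>ends: "\<eta> p = 0" "\<eta> q = 0" using d by (auto simp: \<eta>_def p_def q_def)
  have \<eta>d: "(\<eta> has_real_derivative \<eta>' t) (at t)" if "t \<noteq> t0" for t
  proof (cases "t < t0")
    case True
    have "((\<lambda>t. 1 - (t0 - t) / d) has_real_derivative \<eta>' t) (at t)"
      using True d by (auto simp: \<eta>'_def intro!: derivative_eq_intros)
    then show ?thesis
      by (rule has_field_derivative_transform_within_open[OF _ open_lessThan[of t0]]) (use True in \<open>auto simp: \<eta>_def\<close>)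
  next
    case False
    have "((\<lambda>t. 1 - (t - t0) / d) has_real_derivative \<eta>' t) (at t)"
      using False d by (auto simp: \<eta>'_def intro!: derivative_eq_intros)
    then show ?thesis
      by (rule has_field_derivative_transform_within_open[OF _ open_greaterThan[of t0]]) (use False that in \<open>auto simp: \<eta>_def\<close>)
  qed
  have \<eta>'M: "\<bar>\<eta>' t\<bar> \<le> M" for t using d by (simp add: \<eta>'_def M_def)
  have tangent: "\<gamma> t \<bullet> G t = 0" if "t \<in> {a<..<b} - Z2" for t
  proof -
    have "(\<gamma> has_derivative (\<lambda>h. h *\<^sub>R G t)) (at t)"
      using G(2)[of t] that by (simp add: has_vector_derivative_def)
    from has_derivative_inner[OF this this]
    have "((\<lambda>t. \<gamma> t \<bullet> \<gamma> t) has_derivative (\<lambda>h. 2 * (\<gamma> t \<bullet> G t) * h)) (at t)"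
      by (simp add: inner_commute algebra_simps)
    then have "((\<lambda>t. \<gamma> t \<bullet> \<gamma> t) has_real_derivative 2 * (\<gamma> t \<bullet> G t)) (at t)"
      by (simp add: has_field_derivative_def)
    moreover have "((\<lambda>t. \<gamma> t \<bullet> \<gamma> t) has_real_derivative 0) (at t)"
      by (rule has_field_derivative_transform_within_open[of "\<lambda>_. 1" _ _ "{a<..<b}"])
        (use that n1 in \<open>auto simp: norm_eq_1\<close>)
    ultimately show ?thesis using DERIV_unique by fastforce
  qed
  have u': "g t = grad (\<gamma> t) \<bullet> G t / F (\<gamma> t)" if "t \<in> {p..q} - (Z1 \<union> Z2)" for t
  proof -
    have t: "t \<in> {p..q}" "t \<in> {a..b} - Z2" using that pq by auto
    have "((\<lambda>t. F (\<gamma> t)) has_derivative (\<lambda>h. grad (\<gamma> t) \<bullet> (h *\<^sub>R G t))) (at t)"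
      by (rule has_derivative_compose[OF G(2)[OF t(2), unfolded has_vector_derivative_def] F_derivative[OF ball'(3)[OF t(1)]]])
    then have "((\<lambda>t. F (\<gamma> t)) has_real_derivative (grad (\<gamma> t) \<bullet> G t)) (at t)"
      by (simp add: has_field_derivative_def mult_commute_abs)
    then have "(u has_real_derivative (grad (\<gamma> t) \<bullet> G t) / F (\<gamma> t)) (at t)"
      unfolding u_def[abs_def] using m(1) m(2)[OF t(1)] by (auto intro!: derivative_eq_intros)
    then show ?thesis using g(2)[of t] that DERIV_unique by blast
  qed
  \<comment> \<open>\<open>J\<close> bounds the first variation of the condition length from above.\<close>
  define J where "J = (2 * u t0 - u p - u q) / d"
  have JI: "((\<lambda>t. \<eta>' t * g t) has_integral J) {p..q}"
  proof -
    have "((\<lambda>t. 1 / d * g t) has_integral (1 / d * (u t0 - u p))) {p..t0}"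
      using pq by (intro has_integral_mult_right g(3)) auto
    then have l: "((\<lambda>t. \<eta>' t * g t) has_integral (1 / d * (u t0 - u p))) {p..t0}"
      by (rule has_integral_spike_finite[of "{t0}", rotated 2]) (auto simp: \<eta>'_def)
    have "((\<lambda>t. - 1 / d * g t) has_integral (- 1 / d * (u q - u t0))) {t0..q}"
      using pq by (intro has_integral_mult_right g(3)) auto
    then have r: "((\<lambda>t. \<eta>' t * g t) has_integral (- 1 / d * (u q - u t0))) {t0..q}"
      by (rule has_integral_spike_finite[of "{}", rotated 2]) (auto simp: \<eta>'_def)
    have "1 / d * (u t0 - u p) + (- 1 / d * (u q - u t0)) = J"
      using d by (simp add: J_def field_simps)
    then show ?thesis using has_integral_combine[OF _ _ l r] pq by simp
  qed
  obtain K s0 where s0: "0 < s0" "s0 \<le> 1"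
    and P1: "\<And>s x \<eta> y. \<lbrakk>0 \<le> s; s \<le> s0; x \<in> cball x0 (\<delta> / 2); norm x = 1; m \<le> F x; 0 \<le> \<eta>; \<eta> \<le> 1;
       y = x + (s * \<eta>) *\<^sub>R half_sq_grad x\<rbrakk>
      \<Longrightarrow> 1 \<le> norm y \<and> sgn y \<in> cball x0 \<delta> \<and> 0 < F (sgn y)"
    and P2: "\<And>s x v \<eta> \<eta>' y y'. \<lbrakk>0 \<le> s; s \<le> s0; x \<in> cball x0 (\<delta> / 2); norm x = 1; m \<le> F x; 0 \<le> \<eta>; \<eta> \<le> 1;
       \<bar>\<eta>'\<bar> \<le> M; x \<bullet> v = 0; norm v = F x; y = x + (s * \<eta>) *\<^sub>R half_sq_grad x;
       y' = v + s *\<^sub>R (\<eta>' *\<^sub>R half_sq_grad x + \<eta> *\<^sub>R half_sq_hess x v)\<rbrakk>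
      \<Longrightarrow> norm y' / F (sgn y) \<le> 1 + s * (\<eta>' * (grad x \<bullet> v / F x)) + K * s\<^sup>2"
  proof -
    show thesis
      by (rule pushed_integrand_bound[OF sub B \<delta> M m(1)]) (fact gb hb Db | rule that, assumption+)+
  qed
  \<comment> \<open>The summand 1 of the density bound integrates to \<open>b - a\<close>, the
    length of \<open>\<gamma>\<close> itself, and cancels; the quadratic error is integrated over an
    interval of length \<open>2 * d\<close>.\<close>
  have variation: "0 \<le> s * J + 2 * d * K * s\<^sup>2" if s: "0 < s" "s \<le> s0" for s
  proof -
    define y where "y t = \<gamma> t + (s * \<eta> t) *\<^sub>R half_sq_grad (\<gamma> t)" for t
    \<comment> \<open>The nested form matches the rule for gluing Lipschitz functions; the pieces
      agree at \<open>p\<close> and \<open>q\<close> because the tent vanishes there.\<close>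
    define c where "c t = (if t \<le> p then \<gamma> t else if t \<le> q then sgn (y t) else \<gamma> t)" for t
    have low: "1 \<le> norm (y t)" "sgn (y t) \<in> W" "0 < F (sgn (y t))" "norm (sgn (y t)) = 1" if "t \<in> {p..q}" for t
    proof -
      have *: "1 \<le> norm (y t) \<and> sgn (y t) \<in> cball x0 \<delta> \<and> 0 < F (sgn (y t))"
        by (rule P1[of s "\<gamma> t" "\<eta> t"]) (use s ball'(1) n1' m(2) \<eta>01 that in \<open>auto simp: y_def\<close>)
      then show "1 \<le> norm (y t)" "sgn (y t) \<in> W" "0 < F (sgn (y t))" using sub by auto
      have "y t \<noteq> 0" using * by auto
      then show "norm (sgn (y t)) = 1" by (simp add: norm_sgn)
    qed
    have ends: "sgn (y p) = \<gamma> p" "sgn (y q) = \<gamma> q"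
      using \<eta>ends n1'[of p] n1'[of q] pq by (auto simp: y_def sgn_div_norm)
    have cpq: "c t = sgn (y t)" if "t \<in> {p..q}" for t using that ends by (auto simp: c_def)
    have cout: "c t = \<gamma> t" if "t \<notin> {p<..<q}" for t
      using that ends pq by (cases "t = q") (auto simp: c_def)
    have nX: "norm (half_sq_grad (\<gamma> t)) \<le> 4" if "t \<in> {p..q}" for t
      using norm_sgrad[OF ball'(3)[OF that] n1'[OF that]] F_bounds[OF ball'(3)[OF that] n1'[OF that]] pi_less_4
      by (simp add: half_sq_grad_def)
    \<comment> \<open>Product rule with \<open>s \<le> 1\<close> and \<open>\<eta> \<le> 1\<close>:
      the field is \<open>B\<close>-Lipschitz and of length at most 4, the tent has slope at most
      \<open>M\<close>.\<close>
    define L where "L = C + (B * C + M * 4)"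
    have L0: "0 \<le> L" using C0 B M by (simp add: L_def)
    have yL: "dist (y t1) (y t2) \<le> L * dist t1 t2" if t: "t1 \<in> {p..q}" "t2 \<in> {p..q}" for t1 t2
    proof -
      have "y t1 - y t2 = (\<gamma> t1 - \<gamma> t2) + s *\<^sub>R (\<eta> t1 *\<^sub>R (half_sq_grad (\<gamma> t1) - half_sq_grad (\<gamma> t2)) + (\<eta> t1 - \<eta> t2) *\<^sub>R half_sq_grad (\<gamma> t2))"
        by (simp add: y_def algebra_simps)
      also have "norm \<dots> \<le> norm (\<gamma> t1 - \<gamma> t2) + s * norm (\<eta> t1 *\<^sub>R (half_sq_grad (\<gamma> t1) - half_sq_grad (\<gamma> t2)) + (\<eta> t1 - \<eta> t2) *\<^sub>R half_sq_grad (\<gamma> t2))"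
        using s by (intro norm_triangle_le) simp
      also have "\<dots> \<le> C * dist t1 t2 + 1 * (B * C * dist t1 t2 + M * dist t1 t2 * 4)"
      proof (intro add_mono mult_mono order_trans[OF norm_triangle_ineq])
        show 1: "norm (\<gamma> t1 - \<gamma> t2) \<le> C * dist t1 t2"
          using lipschitz_onD[OF Cpq t] by (simp add: dist_norm)
        have "norm (\<eta> t1 *\<^sub>R (half_sq_grad (\<gamma> t1) - half_sq_grad (\<gamma> t2))) \<le> 1 * norm (half_sq_grad (\<gamma> t1) - half_sq_grad (\<gamma> t2))"
          unfolding norm_scaleR using \<eta>01[OF t(1)] by (intro mult_right_mono) auto
        also have "\<dots> \<le> 1 * (B * norm (\<gamma> t1 - \<gamma> t2))"
          using XL[OF ball'(2)[OF t(1)] ball'(2)[OF t(2)]] by simp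
        also have "\<dots> \<le> 1 * (B * (C * dist t1 t2))" using 1 B by (intro mult_left_mono) auto
        finally show "norm (\<eta> t1 *\<^sub>R (half_sq_grad (\<gamma> t1) - half_sq_grad (\<gamma> t2))) \<le> B * C * dist t1 t2" by simp
        show "norm ((\<eta> t1 - \<eta> t2) *\<^sub>R half_sq_grad (\<gamma> t2)) \<le> M * dist t1 t2 * 4"
          unfolding norm_scaleR using \<eta>L nX[OF t(2)] M by (intro mult_mono) auto
      qed (use s s0 in auto)
      finally show ?thesis by (simp add: dist_norm L_def algebra_simps)
    qed
    have "(2 * L)-lipschitz_on {p..q} (\<lambda>t. sgn (y t))"
    proof (rule lipschitz_onI)
      fix t1 t2 assume t: "t1 \<in> {p..q}" "t2 \<in> {p..q}"
      show "dist (sgn (y t1)) (sgn (y t2)) \<le> 2 * L * dist t1 t2"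
        using dist_sgn_le[OF low(1)[OF t(1)] low(1)[OF t(2)]] yL[OF t] by simp
    qed (use L0 in simp)
    moreover have "C-lipschitz_on {a..p} \<gamma>" "C-lipschitz_on {q..b} \<gamma>"
      using C by (rule lipschitz_on_subset; use pq in auto)+
    ultimately have "(max C (max (2 * L) C))-lipschitz_on {a..b} c"
      unfolding c_def[abs_def] using ends pq
      by (intro lipschitz_on_concat_max) auto
    moreover have "c ` {a..b} \<subseteq> sphere 0 1 - N"
    proof
      fix z assume "z \<in> c ` {a..b}"
      then obtain t where t: "t \<in> {a..b}" "z = c t" by blast
      show "z \<in> sphere 0 1 - N"
      proof (cases "t \<in> {p..q}")
        case True
        then show ?thesis using low[OF True] closest[OF low(2,4)[OF True]] t cpq by auto
      next
        case False
        then have "c t = \<gamma> t" by (intro cout) auto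
        then show ?thesis using t im by (metis image_subset_iff)
      qed
    qed
    ultimately have "lipschitz_curve N a b c" by (auto simp: lipschitz_curve_def)
    moreover have "c a = \<gamma> a" "c b = \<gamma> b" using pq by (auto intro!: cout)
    ultimately have "condition_length N a b \<gamma> \<le> condition_length N a b c"
      using min by (auto simp: condition_minimizing_geodesic_def)
    moreover have "condition_length N a b \<gamma> = ennreal (b - a)"
      using min pq by (auto simp: condition_minimizing_geodesic_def)
    ultimately have len: "ennreal (b - a) \<le> condition_length N a b c" by simp
    \<comment> \<open>Parameters where the speed is not \<open>rho N (\<gamma> t)\<close> or where
      \<open>u\<close> or \<open>\<gamma>\<close> may lack a derivative, together with the kink and
      the ends of the pieces.\<close>
    define Bad where "Bad = Z \<union> Z1 \<union> Z2 \<union> {t0, p, q, a, b}"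
    have Bad: "negligible Bad" using Z(1) g(1) G(1) by (auto simp: Bad_def intro: negligible_Un)
    define h where "h t = (if t \<in> {p..q} then 1 + s * (\<eta>' t * g t) + K * s\<^sup>2 else 1)" for t
    have cb: "norm (vector_derivative c (at t)) / rho N (c t) \<le> h t \<and> 0 < rho N (c t)" if t: "t \<in> {a..b} - Bad" for t
    proof (cases "t \<in> {p..q}")
      case True
      have t': "t \<in> {p<..<q}" "t \<in> {a..b} - Z2" "t \<in> {a<..<b} - Z2" "t \<in> {p..q} - (Z1 \<union> Z2)" "t \<in> {a..b} - Z" "t \<noteq> t0"
        using True t by (auto simp: Bad_def)
      define v where "v = G t"
      have dv: "(\<gamma> has_vector_derivative v) (at t)" unfolding v_def by (rule G(2)[OF t'(2)])
      have nv: "norm v = F (\<gamma> t)" using Z(2)[OF t'(5)] vector_derivative_at[OF dv] F\<gamma>[OF True] by simp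
      have "((\<lambda>t. half_sq_grad (\<gamma> t)) has_derivative (\<lambda>h. half_sq_hess (\<gamma> t) (h *\<^sub>R v))) (at t)"
        by (rule has_derivative_compose[OF dv[unfolded has_vector_derivative_def] half_sq_grad_derivative[OF ball'(3)[OF True]]])
      then have dX: "((\<lambda>t. half_sq_grad (\<gamma> t)) has_vector_derivative half_sq_hess (\<gamma> t) v) (at t)"
        by (simp add: has_vector_derivative_def linear_scale[OF linear_DX[OF ball'(3)[OF True]]])
      define y' where "y' = v + s *\<^sub>R (\<eta>' t *\<^sub>R half_sq_grad (\<gamma> t) + \<eta> t *\<^sub>R half_sq_hess (\<gamma> t) v)"
      have "((\<lambda>t. \<gamma> t + (s * \<eta> t) *\<^sub>R half_sq_grad (\<gamma> t)) has_vector_derivative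
          v + ((s * \<eta> t) *\<^sub>R half_sq_hess (\<gamma> t) v + (s * \<eta>' t) *\<^sub>R half_sq_grad (\<gamma> t))) (at t)"
        by (intro has_vector_derivative_add dv has_vector_derivative_scaleR DERIV_cmult \<eta>d t' dX)
      moreover have "v + ((s * \<eta> t) *\<^sub>R half_sq_hess (\<gamma> t) v + (s * \<eta>' t) *\<^sub>R half_sq_grad (\<gamma> t)) = y'"
        by (simp add: y'_def algebra_simps)
      ultimately have "(y has_vector_derivative y') (at t)" by (simp add: y_def[abs_def])
      then obtain c' where c': "((\<lambda>t. sgn (y t)) has_vector_derivative c') (at t)" "norm c' \<le> norm y'"
        using sgn_derivative_norm_le low(1)[OF True] by metis
      have "(c has_vector_derivative c') (at t)"
        by (rule has_vector_derivative_transform_within_open[OF c'(1) open_greaterThanLessThan t'(1)]) (simp add: cpq)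
      then have vc: "vector_derivative c (at t) = c'" by (rule vector_derivative_at)
      have rc: "rho N (c t) = F (sgn (y t))" using cpq[OF True] F_rho[OF low(2,4)[OF True]] by simp
      have "norm c' / F (sgn (y t)) \<le> norm y' / F (sgn (y t))"
        using c' low(3)[OF True] by (intro divide_right_mono) auto
      also have "\<dots> \<le> 1 + s * (\<eta>' t * (grad (\<gamma> t) \<bullet> v / F (\<gamma> t))) + K * s\<^sup>2"
        by (rule P2[of s "\<gamma> t" "\<eta> t" "\<eta>' t" v "y t" y', OF less_imp_le[OF s(1)] s(2) ball'(1)[OF True] n1'[OF True] m(2)[OF True]
           \<eta>01[OF True] \<eta>'M _ nv _ y'_def]) (use tangent[OF t'(3)] in \<open>auto simp: v_def y_def\<close>)
      also have "\<dots> = h t" using True u'[OF t'(4)] by (simp add: h_def v_def)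
      finally show ?thesis using low(3)[OF True] by (simp add: vc rc)
    next
      case False
      have t': "t \<in> {a..b} - Z2" "t \<in> {a..b} - Z" using t by (auto simp: Bad_def)
      have dv: "(\<gamma> has_vector_derivative G t) (at t)" by (rule G(2)[OF t'(1)])
      have "(c has_vector_derivative G t) (at t)"
        by (rule has_vector_derivative_transform_within_open[OF dv, of "- {p..q}"])
          (use False cout in \<open>auto simp: closed_atLeastAtMost\<close>)
      moreover have "c t = \<gamma> t" using False by (intro cout) auto
      ultimately show ?thesis
        using Z(2)[OF t'(2)] vector_derivative_at[OF dv] pos[of t] t False
        by (auto simp: h_def vector_derivative_at)
    qed
    \<comment> \<open>On \<open>Bad\<close> the function \<open>g\<close> is arbitrary and
      \<open>h\<close> may be negative; setting it to 0 there makes the integrand nonnegative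
      everywhere, so that its Lebesgue and gauge integrals can be compared.\<close>
    define h' where "h' t = (if t \<in> {a..b} then if t \<in> Bad then 0 else h t else 0)" for t
    have h'0: "0 \<le> h' t" for t
    proof (cases "t \<in> {a..b} - Bad")
      case True
      have "0 \<le> norm (vector_derivative c (at t)) / rho N (c t)" using cb[OF True] by simp
      also have "\<dots> \<le> h t" using cb[OF True] by simp
      finally show ?thesis by (simp add: h'_def)
    qed (auto simp: h'_def)
    have "condition_length N a b c \<le> (\<integral>\<^sup>+t. ennreal (h' t) \<partial>lebesgue)"
      unfolding condition_length_def
    proof (rule nn_integral_mono_AE)
      show "AE t in lebesgue. ennreal (norm (vector_derivative c (at t))) * inverse (ennreal (rho N (c t))) * indicator {a..b} t \<le> ennreal (h' t)"
        using AE_lebesgue_not_negligible[OF Bad]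
      proof eventually_elim
        case (elim t)
        show ?case
        proof (cases "t \<in> {a..b}")
          case True
          then have *: "norm (vector_derivative c (at t)) / rho N (c t) \<le> h t" "0 < rho N (c t)"
            using cb[of t] elim by auto
          have "ennreal (norm (vector_derivative c (at t))) * inverse (ennreal (rho N (c t)))
              = ennreal (norm (vector_derivative c (at t)) / rho N (c t))"
            using *(2) by (simp add: divide_inverse ennreal_mult inverse_ennreal)
          also have "\<dots> \<le> ennreal (h t)" using * by (intro ennreal_leI)
          finally show ?thesis using True elim by (simp add: h'_def)
        qed simp
      qed
    qed
    define T where "T = (b - a) + (s * J + 2 * d * K * s\<^sup>2)"
    have hI: "(h has_integral T) {a..b}"
    proof -
      have "((\<lambda>t. s * (\<eta>' t * g t) + K * s\<^sup>2) has_integral (s * J + (q - p) *\<^sub>R (K * s\<^sup>2))) {p..q}"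
        using pq by (intro has_integral_add has_integral_mult_right JI)
          (use has_integral_const_real[of "K * s\<^sup>2" p q] in auto)
      moreover have "{p..q} \<inter> {a..b} = {p..q}" using pq by auto
      moreover have "(q - p) *\<^sub>R (K * s\<^sup>2) = 2 * d * K * s\<^sup>2" by (simp add: p_def q_def)
      ultimately have "((\<lambda>t. if t \<in> {p..q} then s * (\<eta>' t * g t) + K * s\<^sup>2 else 0) has_integral (s * J + 2 * d * K * s\<^sup>2)) {a..b}"
        unfolding has_integral_restrict_Int by (simp only:)
      moreover have "((\<lambda>t. 1) has_integral (b - a)) {a..b}"
        using has_integral_const_real[of "1::real" a b] pq by simp
      ultimately have "((\<lambda>t. 1 + (if t \<in> {p..q} then s * (\<eta>' t * g t) + K * s\<^sup>2 else 0)) has_integral T) {a..b}"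
        unfolding T_def by (intro has_integral_add)
      moreover have "(\<lambda>t. 1 + (if t \<in> {p..q} then s * (\<eta>' t * g t) + K * s\<^sup>2 else 0)) = h"
        by (auto simp: h_def)
      ultimately show ?thesis by simp
    qed
    have "((\<lambda>t. if t \<in> Bad then 0 else h t) has_integral T) {a..b}"
      by (rule has_integral_spike[OF Bad _ hI]) auto
    then have h'I: "(h' has_integral T) UNIV"
      unfolding h'_def[abs_def] by (simp only: has_integral_restrict_UNIV)
    then have "(\<integral>\<^sup>+t. ennreal (h' t) \<partial>lebesgue) = ennreal T" and T0: "0 \<le> T"
      using has_integral_iff_nn_integral_lebesgue[of h' T] h'0 by auto
    then have "ennreal (b - a) \<le> ennreal T"
      using order_trans[OF len \<open>condition_length N a b c \<le> (\<integral>\<^sup>+t. ennreal (h' t) \<partial>lebesgue)\<close>] by simp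
    then have "b - a \<le> T" using T0 by (simp add: ennreal_le_iff)
    then show ?thesis by (simp add: T_def)
  qed
  have "0 \<le> J"
  proof (rule ccontr)
    assume J: "\<not> 0 \<le> J"
    \<comment> \<open>If \<open>J < 0\<close>, then for \<open>s \<le> - J / A\<close> the linear
      term outweighs the quadratic one; the summand 1 makes the comparison strict.\<close>
    define A where "A = 2 * d * \<bar>K\<bar> + 1"
    have A: "0 < A" using d by (simp add: A_def add_nonneg_pos)
    define s where "s = min s0 (- J / A)"
    have "0 < - J / A" using J A by (intro divide_pos_pos) auto
    then have s: "0 < s" "s \<le> s0" using s0 by (auto simp: s_def)
    have "s \<le> - J / A" by (simp add: s_def)
    then have "A * s \<le> - J" using A pos_le_divide_eq[of A s "- J"] by (simp add: mult.commute)
    then have "s * (A * s) \<le> s * (- J)"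
      using s by (intro mult_left_mono) auto
    moreover have "2 * d * K * s\<^sup>2 < A * s\<^sup>2"
    proof (rule mult_strict_right_mono)
      have "2 * d * K \<le> 2 * d * \<bar>K\<bar>" using d by (intro mult_left_mono) auto
      then show "2 * d * K < A" by (simp add: A_def)
    qed (use s in simp)
    ultimately show False using variation[OF s(1,2)] by (simp add: power2_eq_square mult_ac)
  qed
  then have "u p + u q \<le> 2 * u t0" using d by (simp add: J_def zero_le_divide_iff)
  then show ?thesis using F\<gamma>[of p] F\<gamma>[of q] F\<gamma>[of t0] pq by (simp add: u_def p_def q_def)
qed

end

section \<open>From charts to the whole smooth domain\<close>

lemma smooth_domain_chart:
  fixes N :: "'a::euclidean_space set"
  assumes "2 \<le> DIM('a)" "N \<subseteq> sphere 0 1" "x \<in> smooth_domain N"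
  obtains W F F' F'' where "x \<in> W" "smooth_rho_chart N W F F' F''"
proof -
  obtain V where V0: "x \<in> V" "openin (top_of_set (sphere 0 1)) V \<and> V \<subseteq> sphere 0 1 - N \<and>
      (\<forall>x\<in>V. sphere_C2_near (rho N) x \<and> (\<exists>!y. is_closest_point N x y))"
    using assms(3) unfolding smooth_domain_def Union_iff mem_Collect_eq by (elim bexE) simp
  have V: "openin (top_of_set (sphere 0 1)) V" "V \<subseteq> sphere 0 1 - N" "x \<in> V"
    "sphere_C2_near (rho N) x"
    using V0 by simp_all
  have closest: "\<exists>p. is_closest_point N z p" if "z \<in> V" for z
    using V0(2) that ex1_implies_ex by metis
  obtain O1 where O1: "open O1" "V = sphere 0 1 \<inter> O1" using V(1) by (auto simp: openin_open)
  obtain W F where W: "x \<in> W" "C2_on W F" "\<And>z. z \<in> W \<inter> sphere 0 1 \<Longrightarrow> F z = rho N z"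
    using V(4) unfolding sphere_C2_near_def by metis
  obtain F' F'' where F: "open W" "\<And>x. x \<in> W \<Longrightarrow> (F has_derivative blinfun_apply (F' x)) (at x)"
    "\<And>x. x \<in> W \<Longrightarrow> (F' has_derivative blinfun_apply (F'' x)) (at x)" "continuous_on W F''"
    using W(2) unfolding C2_on_def by blast
  show ?thesis
  \<comment> \<open>The extension \<open>F\<close> may live beyond \<open>V\<close>, but closest
    points are needed at all sphere points of the chart; cutting with \<open>O1\<close> leaves only
    points of \<open>V\<close> on the sphere.\<close>
  proof (rule that[of "W \<inter> O1" F F' F''])
    show "x \<in> W \<inter> O1" using W V O1 by auto
    show "smooth_rho_chart N (W \<inter> O1) F F' F''"
    proof
      fix z assume z: "z \<in> W \<inter> O1" "norm z = 1"
      then have "z \<in> V" using O1 by auto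
      then show "z \<notin> N \<and> (\<exists>p. is_closest_point N z p)" using V(2) closest by blast
      show "F z = rho N z" using W(3) z by auto
    qed (use assms F O1 in \<open>auto intro: continuous_on_subset\<close>)
  qed
qed

lemma rho_smooth_domain:
  fixes N :: "'a::euclidean_space set"
  assumes "2 \<le> DIM('a)" "N \<subseteq> sphere 0 1"
  shows "continuous_on (smooth_domain N) (rho N)"
    and "x \<in> smooth_domain N \<Longrightarrow> 0 < rho N x"
proof -
  have S: "smooth_domain N \<subseteq> sphere 0 1" by (auto simp: smooth_domain_def)
  show "0 < rho N x" if x: "x \<in> smooth_domain N"
  proof -
    obtain W F F' F'' where xW: "x \<in> W" "smooth_rho_chart N W F F' F''"
      using smooth_domain_chart[OF assms x] .
    interpret smooth_rho_chart N W F F' F'' by fact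
    have "norm x = 1" using S x by auto
    then show ?thesis using F_bounds(1)[OF xW(1)] F_rho[OF xW(1)] by simp
  qed
  show "continuous_on (smooth_domain N) (rho N)"
    unfolding continuous_on_eq_continuous_within
  proof
    fix x assume x: "x \<in> smooth_domain N"
    obtain W F F' F'' where xW: "x \<in> W" "smooth_rho_chart N W F F' F''"
      using smooth_domain_chart[OF assms x] .
    interpret smooth_rho_chart N W F F' F'' by fact
    have cF: "continuous (at x within smooth_domain N) F"
      using has_derivative_continuous[OF F_derivative[OF xW(1)]] continuous_at_imp_continuous_at_within by blast
    obtain e where e: "0 < e" "ball x e \<subseteq> W" using xW(1) W open_contains_ball by blast
    show "continuous (at x within smooth_domain N) (rho N)"
    proof (rule continuous_transform_within[OF cF e(1) x])
      fix z assume "z \<in> smooth_domain N" "dist z x < e"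
      then have "z \<in> W" "norm z = 1" using S e by (auto simp: dist_commute)
      then show "F z = rho N z" by (rule F_rho)
    qed
  qed
qed

theorem theorem1p2:
  fixes n :: nat and N :: "'a::euclidean_space set"
    and I :: "real set" and \<gamma> :: "real \<Rightarrow> 'a"
  assumes "n \<ge> 1" and "DIM('a) = n + 1"
    and "N \<subseteq> sphere 0 1" and "C2_submanifold N" and "riemannian_complete N"
    and "condition_geodesic N I \<gamma>" and "\<gamma> ` I \<subseteq> smooth_domain N"
  shows "convex_on I (\<lambda>t. ln (1 / rho N (\<gamma> t)))"
proof -
  have dim: "2 \<le> DIM('a)" using assms by simp
  note R = rho_smooth_domain[OF dim assms(3)]
  have pos: "0 < rho N (\<gamma> t)" if "t \<in> I" for t using that assms(7) by (intro R(2)) auto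
  have geo: "\<exists>a b T. openin (top_of_set I) T \<and> t \<in> T \<and> T \<subseteq> {a..b} \<and> {a..b} \<subseteq> I \<and>
        condition_minimizing_geodesic N a b \<gamma>" if "t \<in> I" for t
    using assms(6) that by (auto simp: condition_geodesic_def)
  have c\<gamma>: "continuous_on I \<gamma>"
    unfolding continuous_on_eq_continuous_within
  proof
    fix t assume "t \<in> I"
    then obtain a b T where T: "openin (top_of_set I) T" "t \<in> T" "T \<subseteq> {a..b}" "condition_minimizing_geodesic N a b \<gamma>"
      using geo by metis
    obtain C where "C-lipschitz_on {a..b} \<gamma>"
      using T(4) by (auto simp: condition_minimizing_geodesic_def lipschitz_curve_def)
    then have "continuous_on T \<gamma>"
      using T(3) lipschitz_on_continuous_on continuous_on_subset by blast
    then have "continuous (at t within T) \<gamma>" using T(2) by (simp add: continuous_on_eq_continuous_within)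
    moreover obtain U where "open U" "T = I \<inter> U" using T(1) by (auto simp: openin_open)
    \<comment> \<open>\<open>T\<close> is a neighbourhood of \<open>t\<close> relative to
      \<open>I\<close>, so continuity on the minimizing piece is continuity on
      \<open>I\<close>.\<close>
    then have "at t within T = at t within I" using T(2) by (intro at_within_nhd[of t U]) auto
    ultimately show "continuous (at t within I) \<gamma>" by simp
  qed
  have cr: "continuous_on I (\<lambda>t. rho N (\<gamma> t))"
    by (rule continuous_on_compose2[OF R(1) c\<gamma> assms(7)])
  show ?thesis
  proof (rule locally_midpoint_convex_imp_convex)
    show "is_interval I" using assms(6) by (simp add: condition_geodesic_def)
    show "continuous_on I (\<lambda>t. ln (1 / rho N (\<gamma> t)))"
      using pos by (intro continuous_intros cr) (auto simp: less_imp_neq[symmetric])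
    fix t assume t: "t \<in> interior I"
    then have tI: "t \<in> I" using interior_subset by blast
    obtain a b T where T: "openin (top_of_set I) T" "t \<in> T" "T \<subseteq> {a..b}" "{a..b} \<subseteq> I"
      and min: "condition_minimizing_geodesic N a b \<gamma>"
      using geo[OF tI] by metis
    obtain U where U: "open U" "T = I \<inter> U" using T(1) by (auto simp: openin_open)
    \<comment> \<open>\<open>T\<close> is open only relative to \<open>I\<close>. At an interior
      point of \<open>I\<close> it contains a genuine interval around \<open>t\<close>, so both
      \<open>t - d\<close> and \<open>t + d\<close> lie on the minimizing piece.\<close>
    have "open (interior I \<inter> U)" "t \<in> interior I \<inter> U" using t T U by auto
    then obtain e1 where e1: "0 < e1" "ball t e1 \<subseteq> interior I \<inter> U" using open_contains_ball by blast
    have e1ab: "{t - e1<..<t + e1} \<subseteq> {a..b}"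
      using e1(2) interior_subset[of I] U T(3) by (auto simp: ball_eq_greaterThanLessThan)
    have ab: "a < b" using e1ab e1(1) greaterThanLessThan_subseteq_atLeastAtMost_iff[of "t - e1" "t + e1" a b] by auto
    obtain W F F' F'' where xW: "\<gamma> t \<in> W" "smooth_rho_chart N W F F' F''"
      using smooth_domain_chart[OF dim assms(3), of "\<gamma> t"] assms(7) tI by blast
    interpret smooth_rho_chart N W F F' F'' by fact
    obtain \<delta> B where B: "0 < \<delta>" "cball (\<gamma> t) \<delta> \<subseteq> W" "0 \<le> B"
      "\<And>x. x \<in> cball (\<gamma> t) \<delta> \<Longrightarrow> norm (grad x) \<le> B"
      "\<And>x w. x \<in> cball (\<gamma> t) \<delta> \<Longrightarrow> norm (hess x w) \<le> B * norm w"
      "\<And>x w. x \<in> cball (\<gamma> t) \<delta> \<Longrightarrow> norm (half_sq_hess x w) \<le> B * norm w"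
      using local_bounds[OF xW(1)] by metis
    obtain C where C: "C-lipschitz_on {a..b} \<gamma>"
      using min by (auto simp: condition_minimizing_geodesic_def lipschitz_curve_def)
    obtain Z where Z: "negligible Z"
      "\<And>t. t \<in> {a..b} - Z \<Longrightarrow> norm (vector_derivative \<gamma> (at t)) = rho N (\<gamma> t)"
    proof (rule arclength_unit_speed[OF C ab])
      show "condition_length N s t \<gamma> = ennreal (t - s)" if "a \<le> s" "s \<le> t" "t \<le> b" for s t
        using min that by (auto simp: condition_minimizing_geodesic_def)
      show "continuous_on {a..b} (\<lambda>t. rho N (\<gamma> t))" using cr T(4) continuous_on_subset by blast
      show "0 < rho N (\<gamma> t)" if "t \<in> {a..b}" for t using pos that T(4) by blast
    qed blast
    \<comment> \<open>Staying within \<open>\<delta> / 2\<close> of \<open>\<gamma> t\<close> leaves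
      the other half of the radius for the push.\<close>
    obtain e2 where e2: "0 < e2" "\<And>s. s \<in> I \<Longrightarrow> dist s t < e2 \<Longrightarrow> dist (\<gamma> s) (\<gamma> t) < \<delta> / 2"
      using c\<gamma>[unfolded continuous_on_iff, rule_format, OF tI, of "\<delta> / 2"] B(1) by auto
    show "\<exists>e>0. \<forall>d. 0 < d \<and> d < e \<longrightarrow>
        2 * ln (1 / rho N (\<gamma> t)) \<le> ln (1 / rho N (\<gamma> (t - d))) + ln (1 / rho N (\<gamma> (t + d)))"
    proof (intro exI[of _ "min e1 e2"] conjI allI impI)
      show "0 < min e1 e2" using e1 e2 by simp
      fix d assume d: "0 < d \<and> d < min e1 e2"
      have "t - d \<in> {a..b}" "t + d \<in> {a..b}" by (rule subsetD[OF e1ab]; use d in auto)+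
      then have ab': "a \<le> t - d" "t + d \<le> b" by auto
      then have dab: "{t - d..t + d} \<subseteq> {a..b}" by auto
      have "ln (rho N (\<gamma> (t - d))) + ln (rho N (\<gamma> (t + d))) \<le> 2 * ln (rho N (\<gamma> t))"
      proof (rule midpoint_inequality[OF B(2,3,1,4,5,6) min Z])
        show "0 < rho N (\<gamma> s)" if "s \<in> {a..b}" for s using pos that T(4) by blast
        show "\<gamma> s \<in> cball (\<gamma> t) (\<delta> / 2)" if s: "s \<in> {t - d..t + d}" for s
        proof -
          have "s \<in> I" using s dab T(4) by blast
          moreover have "dist s t < e2" using s d by (auto simp: dist_real_def)
          ultimately show ?thesis using e2(2)[of s] by (simp add: dist_commute)
        qed
      qed (use d ab' in auto)
      moreover have "t - d \<in> I" "t + d \<in> I" using dab T(4) d by auto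
      ultimately show "2 * ln (1 / rho N (\<gamma> t)) \<le> ln (1 / rho N (\<gamma> (t - d))) + ln (1 / rho N (\<gamma> (t + d)))"
        using pos[of t] pos[of "t - d"] pos[of "t + d"] tI by (simp add: ln_div)
    qed
  qed
qed

end
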